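(* Let $K$ be a real quadratic field of discriminant $D>0$ and $\mathscr{B}$ a narrow ideal class of $K$. Then for any natural number $k\ge3$, $$D^{k/2}\,\widetilde{\zeta}(k,\mathscr{B})=\sum_{w\in\mathrm{Red}(\mathscr{B})}(\mathscr{D}_{k-1}\mathscr{F}_k)(w,w').$$
   Context: For $k\ge3$ and $x\in\mathbb{C}\setminus(-\infty,0]$, $\mathscr{F}_k(x)=\sum_{n\ge1}\frac{1}{n^{k-1}}\psi(nx)$, where $\psi=\Gamma'/\Gamma$ is the digamma function. For $n\in\mathbb{N}\cup\{0\}$ and a (sufficiently differentiable) function $F$, the operator $\mathscr{D}_n$ is $$(\mathscr{D}_nF)(x,y)=\sum_{i=0}^n\binom{2n-i}{n}\frac{F^{(i)}(x)-(-1)^iF^{(i)}(y)}{i!\,(y-x)^{n-i}}.$$ Let $K$ be a real quadratic field of discriminant $D>0$, regarded as a subfield of $\mathbb{R}$; $w'$ denotes the Galois conjugate of $w\in K$. A number $w\in K$ is reduced if $w>1>w'>0$; such a number has a purely periodic continued fraction expansion of the "minus" type. If $\mathscr{B}$ is a narrow ideal class of $K$ with length $r=\ell(\mathscr{B})$ and cycle $((b_1,\dots,b_r))$ ($b_i\in\mathbb{Z}$, $b_i\ge2$), there are exactly $r$ reduced numbers $w\in K$ for which $\{1,w\}$ is a basis of some ideal in $\mathscr{B}$, namely $$w_k=b_k-\cfrac{1}{b_{k+1}-\cfrac{1}{\ddots-\cfrac{1}{b_r-\cfrac{1}{b_1-\ddots}}}}\qquad(k=1,\dots,r),$$ and $\mathrm{Red}(\mathscr{B})=\{w_1,\dots,w_r\}$.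 Put $$Q_j(p,q)=\frac{1}{w_j-w_j'}(q+pw_j)(q+pw_j'),\qquad1\le j\le r.$$ The partial zeta function $\widetilde{\zeta}(s,\mathscr{B})$ is defined by $$D^{s/2}\,\widetilde{\zeta}(s,\mathscr{B})=\sum_{j=1}^r\ \sum_{p\ge1,\,q\ge0}\frac{p^s}{Q_j(p,q)^s}.$$ *)

theory Defs
  imports "HOL-Analysis.Analysis" "HOL-Computational_Algebra.Computational_Algebra"
begin

section \<open>Real quadratic fields\<close>

definition real_quadratic_field :: "real set \<Rightarrow> bool" where
  "real_quadratic_field K \<longleftrightarrow>
     1 \<in> K \<and> (\<forall>x\<in>K. \<forall>y\<in>K. x - y \<in> K \<and> x * y \<in> K) \<and> (\<forall>x\<in>K. inverse x \<in> K) \<and>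
     vector_space.dim (\<lambda>(c::rat) (x::real). of_rat c * x) K = 2"

definition field_automorphism :: "real set \<Rightarrow> (real \<Rightarrow> real) \<Rightarrow> bool" where
  "field_automorphism K \<sigma> \<longleftrightarrow> bij_betw \<sigma> K K \<and>
     (\<forall>x\<in>K. \<forall>y\<in>K. \<sigma> (x + y) = \<sigma> x + \<sigma> y \<and> \<sigma> (x * y) = \<sigma> x * \<sigma> y)"

text \<open>The Galois conjugation of \<open>K\<close>; the values outside \<open>K\<close> are fixed by
  \<open>extensional\<close> so that the nontrivial automorphism is unique as a HOL function.\<close>
definition galois_conj :: "real set \<Rightarrow> real \<Rightarrow> real" where
  "galois_conj K =
     (THE \<sigma>. \<sigma> \<in> extensional K \<and> field_automorphism K \<sigma> \<and> (\<exists>x\<in>K. \<sigma> x \<noteq> x))"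

definition ring_of_integers :: "real set \<Rightarrow> real set" where
  "ring_of_integers K = {x \<in> K. algebraic_int x}"

definition is_Z_basis :: "real set \<Rightarrow> real \<Rightarrow> real \<Rightarrow> bool" where
  "is_Z_basis I \<alpha> \<beta> \<longleftrightarrow>
     I = {of_int m * \<alpha> + of_int n * \<beta> | m n :: int. True} \<and>
     (\<forall>m n :: int. of_int m * \<alpha> + of_int n * \<beta> = 0 \<longrightarrow> m = 0 \<and> n = 0)"

definition discriminant :: "real set \<Rightarrow> int" where
  "discriminant K = (THE D. \<exists>\<alpha> \<beta>. is_Z_basis (ring_of_integers K) \<alpha> \<beta> \<and>
     of_int D = (\<alpha> * galois_conj K \<beta> - galois_conj K \<alpha> * \<beta>)\<^sup>2)"

section \<open>Narrow ideal classes\<close>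

text \<open>``Ideal'' means nonzero fractional ideal of the maximal order.\<close>
definition ideals :: "real set \<Rightarrow> real set set" where
  "ideals K = {I. I \<subseteq> K \<and> I \<noteq> {0} \<and> 0 \<in> I \<and> (\<forall>x\<in>I. \<forall>y\<in>I. x - y \<in> I) \<and>
     (\<forall>a\<in>ring_of_integers K. \<forall>x\<in>I. a * x \<in> I) \<and>
     (\<exists>d\<in>ring_of_integers K. d \<noteq> 0 \<and> (\<forall>x\<in>I. d * x \<in> ring_of_integers K))}"

definition narrow_equiv :: "real set \<Rightarrow> (real set \<times> real set) set" where
  "narrow_equiv K = {(I, J). I \<in> ideals K \<and> J \<in> ideals K \<and>
     (\<exists>c\<in>K. c > 0 \<and> galois_conj K c > 0 \<and> J = (\<lambda>x. c * x) ` I)}"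

definition narrow_ideal_classes :: "real set \<Rightarrow> real set set set" where
  "narrow_ideal_classes K = ideals K // narrow_equiv K"

section \<open>Reduced numbers and cycles\<close>

definition reduced :: "real set \<Rightarrow> real \<Rightarrow> bool" where
  "reduced K w \<longleftrightarrow> w \<in> K \<and> w > 1 \<and> 1 > galois_conj K w \<and> galois_conj K w > 0"

definition Red :: "real set \<Rightarrow> real set set \<Rightarrow> real set" where
  "Red K B = {w. reduced K w \<and> (\<exists>I\<in>B. is_Z_basis I 1 w)}"

text \<open>Minus continued fractions: \<open>minus_cf_conv a n\<close> is
  $a_0 - 1/(a_1 - 1/(\cdots - 1/a_n))$.\<close>
primrec minus_cf_conv :: "(nat \<Rightarrow> int) \<Rightarrow> nat \<Rightarrow> real" where
  "minus_cf_conv a 0 = of_int (a 0)"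
| "minus_cf_conv a (Suc n) = of_int (a 0) - 1 / minus_cf_conv (\<lambda>i. a (Suc i)) n"

definition minus_cf :: "(nat \<Rightarrow> int) \<Rightarrow> real" where
  "minus_cf a = lim (minus_cf_conv a)"

text \<open>With \<open>bs = [b\<^sub>1, \<dots>, b\<^sub>r]\<close> the number $w_j$ is \<open>cycle_number bs (j - 1)\<close>:
  indices are shifted to start at \<open>0\<close> and read modulo \<open>r\<close>.\<close>
definition cycle_number :: "int list \<Rightarrow> nat \<Rightarrow> real" where
  "cycle_number bs j = minus_cf (\<lambda>i. bs ! ((j + i) mod length bs))"

text \<open>The numbers $w_1,\dots,w_r$ are pairwise distinct and are exactly the reduced
  numbers attached to the class, so \<open>r\<close> is the minimal period.\<close>
definition is_cycle :: "real set \<Rightarrow> real set set \<Rightarrow> int list \<Rightarrow> bool" where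
  "is_cycle K B bs \<longleftrightarrow> bs \<noteq> [] \<and> (\<forall>b\<in>set bs. b \<ge> 2) \<and>
     bij_betw (cycle_number bs) {..<length bs} (Red K B)"

text \<open>The cycle is determined by the class up to cyclic rotation; \<open>class_cycle\<close> picks
  one representative.\<close>
definition class_cycle :: "real set \<Rightarrow> real set set \<Rightarrow> int list" where
  "class_cycle K B = (SOME bs. is_cycle K B bs)"

definition class_length :: "real set \<Rightarrow> real set set \<Rightarrow> nat" where
  "class_length K B = length (class_cycle K B)"

section \<open>The partial zeta function\<close>

definition Qform :: "real set \<Rightarrow> real set set \<Rightarrow> nat \<Rightarrow> nat \<Rightarrow> nat \<Rightarrow> real" where
  "Qform K B j p q =
     (let w = cycle_number (class_cycle K B) j; w' = galois_conj K w
      in 1 / (w - w') * (of_nat q + of_nat p * w) * (of_nat q + of_nat p * w'))"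

definition partial_zeta :: "complex \<Rightarrow> real set \<Rightarrow> real set set \<Rightarrow> complex" where
  "partial_zeta s K B =
     (\<Sum>j<class_length K B. \<Sum>\<^sub>\<infinity>(p, q)\<in>{1..} \<times> UNIV.
        of_nat p powr s / of_real (Qform K B j p q) powr s)
     / of_int (discriminant K) powr (s / 2)"

section \<open>The functions \<open>\<F>\<^sub>k\<close> and the operators \<open>\<D>\<^sub>n\<close>\<close>

definition herglotz :: "nat \<Rightarrow> complex \<Rightarrow> complex" where
  "herglotz k x = (\<Sum>n. Digamma (of_nat (Suc n) * x) / of_nat (Suc n) ^ (k - 1))"

definition diff_op ::
  "nat \<Rightarrow> (complex \<Rightarrow> complex) \<Rightarrow> complex \<Rightarrow> complex \<Rightarrow> complex" where
  "diff_op n F x y = (\<Sum>i=0..n. of_nat ((2 * n - i) choose n) *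
     (((deriv ^^ i) F x - (-1) ^ i * (deriv ^^ i) F y) / (fact i * (y - x) ^ (n - i))))"

end

theory Submission
  imports Defs "HOL-Complex_Analysis.Cauchy_Integral_Formula"
begin

text \<open>
  The factor $D^{k/2}$ cancels, so the theorem compares two finite sums: one over the cycle
  numbers of the class, one over its reduced numbers.  Two independent facts are needed: the
  cycle numbers run through \<open>Red K B\<close> exactly once, and the summands agree, i.e. for every
  reduced \<open>w\<close> the double series of $p^k / Q(p,q)^k$ equals
  $(\mathcal{D}_{k-1} \mathcal{F}_k)(w, w')$.

  The second fact (\<open>diff_op_herglotz\<close>) holds for all distinct \<open>x\<close>, \<open>y\<close> in the right half-plane.
  Inserting the partial fraction expansion of \<open>\<psi>\<close> turns $\mathcal{F}_k$ into a constant plus the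
  absolutely convergent double series of
  $p^{1-k} \left(\frac{1}{q+1} - \frac{1}{q + pz}\right)$.  Convergence is locally uniform, so the
  operator, a combination of derivatives, may be applied term by term.  It kills constants, and it
  sends $1/(z+a)$ to $(-1)^n (y-x)^{n+1} / ((x+a)(y+a))^{n+1}$; this last evaluation is the
  Chaundy--Bullard identity, a partial fraction identity in two variables with sum \<open>1\<close>.
  The terms that appear are exactly those of the zeta series.

  For the first fact the reduction theory of a narrow class is developed from lattices.  Conjugation
  embeds an ideal \<open>I\<close> as a lattice in the plane by $x \mapsto (x, x')$.  A totally positive element
  \<open>Y\<close> of least trace, together with a suitable \<open>X\<close> of least determinant against \<open>Y\<close>, spans a
  triangle without lattice points, hence is a basis, and \<open>X / Y\<close> is reduced
  (\<open>Red_nonempty\<close>).  Multiplication by \<open>\<theta>\<close> preserves the lattice spanned by \<open>1\<close> and \<open>w\<close>, and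
  reducedness bounds its integer matrix (\<open>finite_Red\<close>).  The step
  $w \mapsto 1 / (\lceil w \rceil - w)$ of the minus continued fraction maps \<open>Red K B\<close>
  injectively to itself, hence permutes it.  The permutation has a single orbit: the matrix that
  relates two reduced bases of the same lattice is stripped off step by step
  (\<open>reduced_chain\<close>), with an entry decreasing until reducedness forces it to be the identity.
  The ceilings along the orbit therefore form a cycle of the class, and their periodic continued
  fractions converge back to the reduced numbers (\<open>minus_cf_eq\<close>).
\<close>

section \<open>The operator on simple fractions\<close>

text \<open>The Chaundy--Bullard identity.  Raising \<open>m\<close> by one leaves the left-hand side unchanged: by
  Pascal's rule, multiplying the truncated series of $(1-a)^{-m-2}$ by $1 - a$ gives the one of
  $(1-a)^{-m-1}$ up to a single boundary term, which is what the second sum gains.\<close>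

lemma chaundy_bullard:
  fixes a b :: "'a::comm_ring_1"
  assumes "a + b = 1"
  shows "b ^ Suc m * (\<Sum>j\<le>n. of_nat ((m + j) choose j) * a ^ j)
       + a ^ Suc n * (\<Sum>j\<le>m. of_nat ((n + j) choose j) * b ^ j) = 1"
proof (induction m)
  case 0
  have "b * (\<Sum>j\<le>n. a ^ j) = 1 - a ^ Suc n" for n
  proof -
    have b: "b = 1 - a" using assms by (simp add: algebra_simps)
    show ?thesis unfolding b using one_diff_power_eq[of a "Suc n"] by (simp add: lessThan_Suc_atMost)
  qed
  then show ?case by simp
next
  case (Suc m)
  have b: "b = 1 - a" using assms by (simp add: algebra_simps)
  define G where "G = (\<lambda>m n. \<Sum>j\<le>n. of_nat ((m + j) choose j) * a ^ j)"
  have G: "b * G (Suc m) n = G m n - of_nat ((Suc m + n) choose n) * a ^ Suc n" for n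
  proof (induction n)
    case 0 then show ?case by (simp add: G_def b)
  next
    case (Suc n)
    have r: "G m (Suc n) = G m n + of_nat ((m + Suc n) choose Suc n) * a ^ Suc n" for m
      by (simp add: G_def)
    have c: "(Suc m + Suc n) choose Suc n = ((Suc m + n) choose n) + ((m + Suc n) choose Suc n)"
      by simp
    have "b * G (Suc m) (Suc n) = G m n - of_nat ((Suc m + n) choose n) * a ^ Suc n
        + b * (of_nat ((Suc m + Suc n) choose Suc n) * a ^ Suc n)"
      by (simp only: r distrib_left Suc.IH)
    also have "\<dots> = G m (Suc n) - of_nat ((Suc m + Suc n) choose Suc n) * a ^ Suc (Suc n)"
      unfolding r[of m] c by (simp add: b algebra_simps)
    finally show ?case .
  qed
  have sym: "(Suc m + n) choose n = ((n + Suc m) choose Suc m)"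
    by (metis add.commute binomial_symmetric le_add1 add_diff_cancel_left')
  have "b ^ Suc (Suc m) * G (Suc m) n = b ^ Suc m * G m n
      - a ^ Suc n * (of_nat ((n + Suc m) choose Suc m) * b ^ Suc m)"
    using arg_cong[OF G[of n], of "\<lambda>t. b ^ Suc m * t"] unfolding sym
    by (simp add: algebra_simps)
  moreover have "(\<Sum>j\<le>Suc m. of_nat ((n + j) choose j) * b ^ j)
      = (\<Sum>j\<le>m. of_nat ((n + j) choose j) * b ^ j) + of_nat ((n + Suc m) choose Suc m) * b ^ Suc m"
    by (rule sum.atMost_Suc)
  ultimately show ?case using Suc.IH unfolding G_def
    by (simp only: distrib_left) (simp only: diff_add_eq add_diff_cancel_right' flip: add.assoc)
qed

lemma higher_deriv_shifted_inverse:
  fixes a :: complex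
  assumes "z + a \<noteq> 0"
  shows "(deriv ^^ i) (\<lambda>z. 1 / (z + a)) z = (-1) ^ i * fact i / (z + a) ^ Suc i"
proof -
  have "(deriv ^^ i) (\<lambda>z. 1 / (z + a)) z = (-1) ^ i * fact i / (z + a) ^ Suc i" if "z \<in> -{-a}" for z
    using that
  proof (induction i arbitrary: z)
    case 0 then show ?case by simp
  next
    case (Suc i)
    have nz: "z + a \<noteq> 0" using Suc.prems by (simp add: eq_neg_iff_add_eq_0)
    have "eventually (\<lambda>w. w \<in> -{-a}) (nhds z)"
      using Suc.prems by (intro eventually_nhds_in_open) auto
    then have "eventually (\<lambda>w. (deriv ^^ i) (\<lambda>z. 1 / (z + a)) w = (-1) ^ i * fact i / (w + a) ^ Suc i) (nhds z)"
      by eventually_elim (rule Suc.IH)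
    then have "deriv ((deriv ^^ i) (\<lambda>z. 1 / (z + a))) z = deriv (\<lambda>w. (-1) ^ i * fact i / (w + a) ^ Suc i) z"
      by (rule deriv_cong_ev) simp
    also have "\<dots> = (-1) ^ Suc i * fact (Suc i) / (z + a) ^ Suc (Suc i)"
      by (rule DERIV_imp_deriv) (use nz in \<open>auto intro!: derivative_eq_intros simp: divide_simps simp del: of_nat_Suc, cases i, auto simp: algebra_simps\<close>)
    finally show ?case by simp
  qed
  moreover have "z \<in> -{-a}" using assms by (auto simp: eq_neg_iff_add_eq_0)
  ultimately show ?thesis by blast
qed

text \<open>With $\alpha = -(x+a)/(y-x)$ and $\beta = (y+a)/(y-x)$ one has $\alpha + \beta = 1$, and after
  clearing denominators the sum defining the operator is the symmetric case $m = n$ of the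
  Chaundy--Bullard identity.\<close>

lemma diff_op_shifted_inverse:
  fixes x y a :: complex
  assumes xa: "x + a \<noteq> 0" and ya: "y + a \<noteq> 0" and xy: "x \<noteq> y"
  shows "diff_op n (\<lambda>z. 1 / (z + a)) x y
           = (-1) ^ n * (y - x) ^ Suc n / ((x + a) * (y + a)) ^ Suc n"
proof -
  define X Y \<delta> where "X = x + a" and "Y = y + a" and "\<delta> = y - x"
  define \<alpha> \<beta> where "\<alpha> = - X / \<delta>" and "\<beta> = Y / \<delta>"
  have nz: "X \<noteq> 0" "Y \<noteq> 0" "\<delta> \<noteq> 0" using assms by (auto simp: X_def Y_def \<delta>_def)
  have ab: "\<alpha> + \<beta> = 1" unfolding \<alpha>_def \<beta>_def using nz
    by (simp add: X_def Y_def \<delta>_def flip: add_divide_distrib)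
  have Xa: "X = - \<alpha> * \<delta>" and Yb: "Y = \<beta> * \<delta>" and ne: "\<alpha> \<noteq> 0" "\<beta> \<noteq> 0"
    using nz by (auto simp: \<alpha>_def \<beta>_def)
  have summand: "of_nat ((2 * n - i) choose n) *
     (((-1) ^ i * fact i / X ^ Suc i - (-1) ^ i * ((-1) ^ i * fact i / Y ^ Suc i)) / (fact i * \<delta> ^ (n - i)))
     = - (1 / (\<delta> ^ Suc n * (\<alpha> * \<beta>) ^ Suc n)) *
       (of_nat ((n + (n - i)) choose (n - i)) * (\<beta> ^ Suc n * \<alpha> ^ (n - i) + \<alpha> ^ Suc n * \<beta> ^ (n - i)))"
    if "i \<le> n" for i
  proof -
    obtain j where n: "n = i + j" using \<open>i \<le> n\<close> le_Suc_ex by blast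
    have c: "(2 * n - i) choose n = ((n + (n - i)) choose (n - i))"
      using binomial_symmetric[of n "n + (n - i)"] \<open>i \<le> n\<close> by (simp add: mult_2)
    have s: "(-1) ^ i * ((-1) ^ i :: complex) = 1"
      by (simp flip: power_mult_distrib)
    have "((-1) ^ i * fact i / X ^ Suc i - (-1) ^ i * ((-1) ^ i * fact i / Y ^ Suc i)) / (fact i * \<delta> ^ (n - i))
      = ((-1) ^ i / X ^ Suc i - 1 / Y ^ Suc i) / \<delta> ^ (n - i)"
    proof -
      have "(-1) ^ i * fact i / X ^ Suc i - (-1) ^ i * ((-1) ^ i * fact i / Y ^ Suc i)
          = fact i * ((-1) ^ i / X ^ Suc i - 1 / Y ^ Suc i)"
        using s by (simp add: right_diff_distrib flip: mult.assoc)
      then show ?thesis by simp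
    qed
    also have "(-1) ^ i / X ^ Suc i = - 1 / (\<alpha> * \<delta>) ^ Suc i"
    proof -
      have "X ^ Suc i = - ((-1) ^ i * (\<alpha> * \<delta>) ^ Suc i)"
        unfolding Xa by (simp add: power_mult_distrib power_minus[of "\<alpha>*\<delta>"])
      then show ?thesis using s ne nz by (simp add: field_simps)
    qed
    also have "(- 1 / (\<alpha> * \<delta>) ^ Suc i - 1 / Y ^ Suc i) / \<delta> ^ (n - i)
       = - (1 / (\<delta> ^ Suc n * (\<alpha> * \<beta>) ^ Suc n)) * (\<beta> ^ Suc n * \<alpha> ^ (n - i) + \<alpha> ^ Suc n * \<beta> ^ (n - i))"
      unfolding Yb using ne nz by (simp add: n field_simps power_add power_mult_distrib)
    finally show ?thesis unfolding c by (simp add: mult_ac)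
  qed
  have "diff_op n (\<lambda>z. 1 / (z + a)) x y = (\<Sum>i=0..n. - (1 / (\<delta> ^ Suc n * (\<alpha> * \<beta>) ^ Suc n)) *
       (of_nat ((n + (n - i)) choose (n - i)) * (\<beta> ^ Suc n * \<alpha> ^ (n - i) + \<alpha> ^ Suc n * \<beta> ^ (n - i))))"
    unfolding diff_op_def higher_deriv_shifted_inverse[OF xa] higher_deriv_shifted_inverse[OF ya]
    by (intro sum.cong refl) (use summand in \<open>auto simp: X_def Y_def \<delta>_def\<close>)
  also have "\<dots> = (\<Sum>i\<le>n. - (1 / (\<delta> ^ Suc n * (\<alpha> * \<beta>) ^ Suc n)) *
       (of_nat ((n + i) choose i) * (\<beta> ^ Suc n * \<alpha> ^ i + \<alpha> ^ Suc n * \<beta> ^ i)))"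
    by (rule sum.reindex_bij_witness[of _ "\<lambda>i. n - i" "\<lambda>i. n - i"]) auto
  also have "\<dots> = - (1 / (\<delta> ^ Suc n * (\<alpha> * \<beta>) ^ Suc n)) *
     (\<beta> ^ Suc n * (\<Sum>j\<le>n. of_nat ((n + j) choose j) * \<alpha> ^ j)
       + \<alpha> ^ Suc n * (\<Sum>j\<le>n. of_nat ((n + j) choose j) * \<beta> ^ j))"
    by (simp only: sum_distrib_left flip: sum.distrib) (simp add: algebra_simps)
  also have "\<dots> = - (1 / (\<delta> ^ Suc n * (\<alpha> * \<beta>) ^ Suc n))"
    by (simp only: chaundy_bullard[OF ab] mult_1_right)
  also have "\<dots> = (-1) ^ n * \<delta> ^ Suc n / (X * Y) ^ Suc n"
  proof -
    have s: "(-1) ^ n * ((-1) ^ n :: complex) = 1"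
      by (simp flip: power_mult_distrib)
    have e: "X * Y = - (\<alpha> * \<beta>) * (\<delta> * \<delta>)" unfolding Xa Yb by simp
    have "(X * Y) ^ Suc n = - ((-1) ^ n * ((\<alpha> * \<beta>) ^ Suc n * (\<delta> * \<delta>) ^ Suc n))"
      unfolding e power_mult_distrib[of "- (\<alpha> * \<beta>)"] power_minus[of "\<alpha>*\<beta>"] by simp
    then show ?thesis using ne nz s by (simp add: field_simps power_mult_distrib)
  qed
  finally show ?thesis by (simp add: X_def Y_def \<delta>_def)
qed

lemma diff_op_cong:
  assumes "eventually (\<lambda>z. F z = G z) (nhds x)" "eventually (\<lambda>z. F z = G z) (nhds y)"
  shows "diff_op n F x y = diff_op n G x y"
proof -
  have "(deriv ^^ i) F x = (deriv ^^ i) G x" "(deriv ^^ i) F y = (deriv ^^ i) G y" for i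
    by (rule higher_deriv_cong_ev[OF assms(1) refl], rule higher_deriv_cong_ev[OF assms(2) refl])
  then show ?thesis by (simp add: diff_op_def)
qed

text \<open>Additive constants only enter the summand $i = 0$, which is a difference of values, and
  cancel there.\<close>

lemma diff_op_affine:
  assumes S: "open S" "x \<in> S" "y \<in> S" and F: "F holomorphic_on S"
  shows "diff_op n (\<lambda>z. c + d * F z) x y = d * diff_op n F x y"
proof -
  have e: "(deriv ^^ i) (\<lambda>z. c + d * F z) z = (if i = 0 then c else 0) + d * (deriv ^^ i) F z"
    if "z \<in> S" for i z
  proof -
    have "(\<lambda>z. d * F z) holomorphic_on S" by (intro holomorphic_intros F)
    then show ?thesis
      using higher_deriv_add[OF _ _ S(1) that, of "\<lambda>_. c" "\<lambda>z. d * F z" i]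
        higher_deriv_cmult[OF F that S(1), of i d] higher_deriv_const[of i c]
      by auto
  qed
  show ?thesis
    unfolding diff_op_def sum_distrib_left
    by (intro sum.cong refl) (auto simp: e S algebra_simps diff_divide_distrib add_divide_distrib)
qed

lemma diff_op_sum:
  assumes S: "open S" "x \<in> S" "y \<in> S" and F: "\<And>a. a \<in> A \<Longrightarrow> F a holomorphic_on S"
    and A: "finite A"
  shows "diff_op n (\<lambda>z. \<Sum>a\<in>A. F a z) x y = (\<Sum>a\<in>A. diff_op n (F a) x y)"
proof -
  have e: "(deriv ^^ i) (\<lambda>z. \<Sum>a\<in>A. F a z) z = (\<Sum>a\<in>A. (deriv ^^ i) (F a) z)" if "z \<in> S" for i z
    using A F
  proof (induction A rule: finite_induct)
    case empty show ?case by (simp add: higher_deriv_const)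
  next
    case (insert a A)
    have "(deriv ^^ i) (\<lambda>z. F a z + (\<Sum>a\<in>A. F a z)) z = (deriv ^^ i) (F a) z + (deriv ^^ i) (\<lambda>z. \<Sum>a\<in>A. F a z) z"
      by (intro higher_deriv_add[OF _ _ S(1) that] holomorphic_intros insert.prems) auto
    then show ?case using insert by simp
  qed
  show ?thesis
    unfolding diff_op_def e[OF S(2)] e[OF S(3)]
    by (subst sum.swap) (simp add: sum_subtractf sum_distrib_left sum_divide_distrib right_diff_distrib diff_divide_distrib)
qed

text \<open>Uniform convergence of holomorphic functions passes to all derivatives, and the operator is a
  finite combination of these; so it can be applied to an unordered series term by term.\<close>

lemma has_sum_diff_op:
  fixes F :: "'i \<Rightarrow> complex \<Rightarrow> complex"
  assumes S: "open S" "x \<in> S" "y \<in> S" and F: "\<And>a. a \<in> A \<Longrightarrow> F a holomorphic_on S"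
    and lim: "uniform_limit S (\<lambda>X z. \<Sum>a\<in>X. F a z) G (finite_subsets_at_top A)"
  shows "((\<lambda>a. diff_op n (F a) x y) has_sum diff_op n G x y) A"
proof -
  have fin: "eventually (\<lambda>X. finite X \<and> X \<subseteq> A) (finite_subsets_at_top A)"
    by (rule eventually_finite_subsets_at_top_weakI) auto
  have holo: "eventually (\<lambda>X. (\<lambda>z. \<Sum>a\<in>X. F a z) holomorphic_on S) (finite_subsets_at_top A)"
    using fin by eventually_elim (use F in \<open>auto intro!: holomorphic_intros\<close>)
  have d: "((\<lambda>X. (deriv ^^ i) (\<lambda>z. \<Sum>a\<in>X. F a z) z) \<longlongrightarrow> (deriv ^^ i) G z) (finite_subsets_at_top A)"
    if "z \<in> S" for i z
    by (rule higher_deriv_complex_uniform_limit[OF lim holo _ S(1) that]) simp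
  have "((\<lambda>X. diff_op n (\<lambda>z. \<Sum>a\<in>X. F a z) x y) \<longlongrightarrow> diff_op n G x y) (finite_subsets_at_top A)"
    unfolding diff_op_def
    by (cases "x = y") (auto intro!: tendsto_intros tendsto_eq_intros d S simp: divide_inverse)
  moreover have "eventually (\<lambda>X. diff_op n (\<lambda>z. \<Sum>a\<in>X. F a z) x y = (\<Sum>a\<in>X. diff_op n (F a) x y))
      (finite_subsets_at_top A)"
    using fin by eventually_elim (use F in \<open>auto intro!: diff_op_sum[OF S]\<close>)
  ultimately show ?thesis unfolding has_sum_def
    using tendsto_cong by fast
qed

section \<open>The Herglotz function as a double series\<close>

text \<open>The pair \<open>(n, q)\<close> stands for the summand with $p = n + 1$, so that the index set is all pairs
  of natural numbers.\<close>

definition herglotz_term :: "nat \<Rightarrow> nat \<times> nat \<Rightarrow> complex \<Rightarrow> complex" where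
  "herglotz_term k = (\<lambda>(n, q) z.
     (inverse (of_nat (Suc q)) - inverse (of_nat (Suc n) * z + of_nat q)) / of_nat (Suc n) ^ (k - 1))"

text \<open>The difference of the two reciprocals has numerator of order \<open>p\<close>, absorbed by
  $p^{1-k} \le p^{-2}$.  In the denominator, the bound
  $q + p \ge \sqrt{p (q+1)}$ distributes the decay evenly, so that the majorant is a product of
  two convergent series.\<close>

lemma norm_herglotz_term_le:
  assumes a: "0 < a" "a \<le> 1" and z: "a \<le> Re z" "norm z \<le> R" and k: "k \<ge> 3"
  shows "norm (herglotz_term k (n, q) z)
    \<le> (R + 1) / a * (real (Suc n) powr (-3/2) * real (Suc q) powr (-3/2))"
proof -
  define p where "p = real (Suc n)"
  have p: "p \<ge> 1" by (simp add: p_def)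
  define s where "s = real (Suc q)"
  have s: "s \<ge> 1" by (simp add: s_def)
  define w where "w = of_nat (Suc n) * z + of_nat q"
  have R: "R \<ge> 0" using z(2) norm_ge_zero order_trans by blast
  have "a * sqrt (p * s) \<le> norm w"
  proof -
    have "p * s \<le> (p + real q)\<^sup>2"
    proof -
      have "p * s = p * (1 + real q)" by (simp add: s_def)
      also have "\<dots> \<le> (p + real q) * (p + real q)" using p by (intro mult_mono) auto
      finally show ?thesis by (simp add: power2_eq_square)
    qed
    then have "sqrt (p * s) \<le> p + real q" using p by (simp add: real_le_lsqrt)
    then have "a * sqrt (p * s) \<le> a * (p + real q)" using a by simp
    also have "\<dots> \<le> p * a + real q"
      using a by (simp add: distrib_left mult.commute mult_left_le_one_le)
    also have "\<dots> \<le> p * Re z + real q" using z p by simp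
    also have "\<dots> = Re w" by (simp add: w_def p_def)
    also have "\<dots> \<le> norm w" by (rule complex_Re_le_cmod)
    finally show ?thesis .
  qed
  moreover have pos: "0 < a * sqrt (p * s)" using a p s by simp
  ultimately have w: "a * sqrt (p * s) \<le> norm w" "w \<noteq> 0" by auto
  have "norm (of_nat (Suc n) * z - 1) \<le> p * norm z + 1"
    using norm_triangle_ineq4[of "of_nat (Suc n) * z" 1] by (simp add: norm_mult p_def del: of_nat_Suc)
  also have "\<dots> \<le> p * R + p * 1" using z p by (intro add_mono mult_left_mono) auto
  finally have num: "norm (of_nat (Suc n) * z - 1) \<le> p * (R + 1)" by (simp add: distrib_left)
  have "inverse (of_nat (Suc q)) - inverse w = (w - of_nat (Suc q)) / (of_nat (Suc q) * w)"
    using w(2) by (simp add: divide_simps del: of_nat_Suc)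
  also have "w - of_nat (Suc q) = of_nat (Suc n) * z - 1" by (simp add: w_def)
  finally have "norm (herglotz_term k (n, q) z) = norm (of_nat (Suc n) * z - 1) / (s * norm w) / p ^ (k - 1)"
    by (simp add: herglotz_term_def w_def[symmetric] norm_divide norm_mult norm_power s_def p_def del: of_nat_Suc)
  also have "\<dots> \<le> p * (R + 1) / (s * (a * sqrt (p * s))) / p ^ 2"
  proof (rule frac_le)
    show "norm (of_nat (Suc n) * z - 1) / (s * norm w) \<le> p * (R + 1) / (s * (a * sqrt (p * s)))"
      using num w pos s R p a by (intro frac_le mult_left_mono mult_pos_pos) auto
    show "p ^ 2 \<le> p ^ (k - 1)" using p k by (intro power_increasing) auto
  qed (use p s R pos in auto)
  also have "\<dots> = (R + 1) / a * (1 / (p * sqrt p) * (1 / (s * sqrt s)))"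
    using p s a by (simp add: real_sqrt_mult field_simps power2_eq_square)
  also have "1 / (t * sqrt t) = t powr (-3/2)" if "t \<ge> 1" for t :: real
  proof -
    have "t * sqrt t = t powr 1 * t powr (1/2)" using that by (simp add: powr_half_sqrt)
    also have "\<dots> = t powr (1 + 1/2)" by (rule powr_add[symmetric])
    also have "\<dots> = t powr (3/2)" by simp
    finally show ?thesis by (simp add: powr_minus_divide)
  qed
  note this[OF p]
  also have "1 / (s * sqrt s) = s powr (-3/2)" using \<open>\<And>t. t \<ge> 1 \<Longrightarrow> 1 / (t * sqrt t) = t powr (-3/2)\<close>[OF s] .
  finally show ?thesis by (simp add: p_def s_def)
qed

lemma summable_powr_grid:
  "(\<lambda>(n, q). C * (real (Suc n) powr (-3/2) * real (Suc q) powr (-3/2))) summable_on UNIV"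
proof -
  have "summable (\<lambda>n. real n powr (-3/2))" by (subst summable_real_powr_iff) simp
  then have s: "summable (\<lambda>n. real (Suc n) powr (-3/2))" by (subst summable_Suc_iff)
  then have h: "(\<lambda>n. real (Suc n) powr (-3/2)) summable_on UNIV"
    by (subst summable_on_UNIV_nonneg_real_iff) auto
  define L where "L = (\<Sum>\<^sub>\<infinity>n. real (Suc n) powr (-3/2))"
  have L: "((\<lambda>n. real (Suc n) powr (-3/2)) has_sum L) UNIV"
    unfolding L_def using h by (rule has_sum_infsum)
  have "(\<lambda>(n, q). real (Suc n) powr (-3/2) * real (Suc q) powr (-3/2)) summable_on Sigma UNIV (\<lambda>_. UNIV)"
  proof (rule summable_on_SigmaI)
    show "((\<lambda>q. (case (n, q) of (n, q) \<Rightarrow> real (Suc n) powr (-3/2) * real (Suc q) powr (-3/2)))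
        has_sum (real (Suc n) powr (-3/2) * L)) UNIV" for n
      using has_sum_cmult_right[OF L] by simp
    show "(\<lambda>n. real (Suc n) powr (-3/2) * L) summable_on UNIV"
      by (intro summable_on_cmult_left h)
  qed auto
  then have "(\<lambda>x. C * (case x of (n, q) \<Rightarrow> real (Suc n) powr (-3/2) * real (Suc q) powr (-3/2))) summable_on UNIV"
    by (intro summable_on_cmult_right) simp
  then show ?thesis by (simp add: case_prod_unfold)
qed

text \<open>Summation over \<open>q\<close> first produces the digamma function up to the Euler--Mascheroni constant;
  the absolute bound allows this order of summation.\<close>

lemma herglotz_eq_infsum:
  assumes z: "Re z > 0" and k: "k \<ge> 3"
  shows "herglotz k z = - of_real euler_mascheroni * (\<Sum>n. 1 / of_nat (Suc n) ^ (k - 1))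
           + (\<Sum>\<^sub>\<infinity>i. herglotz_term k i z)"
proof -
  define a where "a = min 1 (Re z)"
  have a: "0 < a" "a \<le> 1" "a \<le> Re z" using z by (auto simp: a_def)
  have "(\<lambda>i. norm (herglotz_term k i z)) summable_on UNIV"
    by (rule summable_on_comparison_test[OF summable_powr_grid[of "(norm z + 1) / a"]])
      (use norm_herglotz_term_le[OF a order_refl k] in \<open>auto simp del: of_nat_Suc\<close>)
  then have sm: "(\<lambda>i. herglotz_term k i z) summable_on UNIV \<times> UNIV"
    using abs_summable_summable by simp
  then have "((\<lambda>i. herglotz_term k i z) has_sum (\<Sum>\<^sub>\<infinity>i. herglotz_term k i z)) (UNIV \<times> UNIV)"
    by (simp add: has_sum_infsum)
  moreover have "((\<lambda>q. herglotz_term k (n, q) z) has_sum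
       (Digamma (of_nat (Suc n) * z) + of_real euler_mascheroni) / of_nat (Suc n) ^ (k - 1)) UNIV" for n
  proof -
    have "of_nat (Suc n) * z \<noteq> 0" using z by (auto simp del: of_nat_Suc)
    then have "(\<lambda>q. inverse (of_nat (Suc q)) - inverse (of_nat (Suc n) * z + of_nat q))
        sums (Digamma (of_nat (Suc n) * z) + of_real euler_mascheroni)"
      unfolding Digamma_def of_real_euler_mascheroni diff_add_cancel by (intro summable_sums summable_Digamma)
    then have "(\<lambda>q. herglotz_term k (n, q) z) sums
       ((Digamma (of_nat (Suc n) * z) + of_real euler_mascheroni) / of_nat (Suc n) ^ (k - 1))"
      unfolding herglotz_term_def prod.case by (rule sums_divide)
    moreover have "(\<lambda>q. herglotz_term k (n, q) z) summable_on UNIV"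
      by (rule summable_on_SigmaD1[of "\<lambda>n q. herglotz_term k (n, q) z" UNIV "\<lambda>_. UNIV"])
        (use sm in \<open>auto simp: case_prod_unfold\<close>)
    ultimately show ?thesis
      by (metis has_sum_imp_sums has_sum_infsum sums_unique2)
  qed
  ultimately have "((\<lambda>n. (Digamma (of_nat (Suc n) * z) + of_real euler_mascheroni) / of_nat (Suc n) ^ (k - 1))
      has_sum (\<Sum>\<^sub>\<infinity>i. herglotz_term k i z)) UNIV"
    by (rule has_sum_SigmaD)
  then have 1: "(\<lambda>n. (Digamma (of_nat (Suc n) * z) + of_real euler_mascheroni) / of_nat (Suc n) ^ (k - 1))
      sums (\<Sum>\<^sub>\<infinity>i. herglotz_term k i z)" by (rule has_sum_imp_sums)
  have "summable (\<lambda>n. 1 / of_nat (Suc n) ^ (k - 1) :: complex)"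
  proof -
    have "summable (\<lambda>n. inverse (of_nat n ^ (k - 1)) :: complex)"
      using k by (intro inverse_power_summable) simp
    then show ?thesis by (subst (asm) summable_Suc_iff[symmetric]) (simp add: field_simps del: of_nat_Suc)
  qed
  then have 2: "(\<lambda>n. of_real euler_mascheroni * (1 / of_nat (Suc n) ^ (k - 1)))
      sums (of_real euler_mascheroni * (\<Sum>n. 1 / of_nat (Suc n) ^ (k - 1)) :: complex)"
    by (intro sums_mult summable_sums)
  have "(\<lambda>n. Digamma (of_nat (Suc n) * z) / of_nat (Suc n) ^ (k - 1)) sums
     ((\<Sum>\<^sub>\<infinity>i. herglotz_term k i z) - of_real euler_mascheroni * (\<Sum>n. 1 / of_nat (Suc n) ^ (k - 1)))"
    using sums_diff[OF 1 2] by (simp add: add_divide_distrib del: of_nat_Suc)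
  then show ?thesis unfolding herglotz_def by (simp add: sums_iff)
qed

text \<open>A term is an affine function of $1/(z + q/p)$ with slope $-p^{-k}$.  The sign
  $-(-1)^{k-1}$ turns $(y-x)^k$ into $(x-y)^k$.\<close>

lemma diff_op_herglotz_term:
  assumes x: "Re x > 0" and y: "Re y > 0" and xy: "x \<noteq> y" and k: "k \<ge> 1"
  shows "diff_op (k - 1) (herglotz_term k (n, q)) x y =
    (of_nat (Suc n) / (1 / (x - y) * (of_nat q + of_nat (Suc n) * x) * (of_nat q + of_nat (Suc n) * y))) ^ k"
proof -
  define p where "p = (of_nat (Suc n) :: complex)"
  define a where "a = of_nat q / p"
  have p: "p \<noteq> 0" by (simp add: p_def del: of_nat_Suc)
  have pr: "p = of_real (real (Suc n))" by (simp add: p_def)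
  have a: "a = of_real (real q / real (Suc n))" by (simp add: a_def p_def)
  have nz: "z + a \<noteq> 0" if "Re z > 0" for z
    using that unfolding a
    by (metis add_pos_nonneg complex_Re_of_nat divide_nonneg_nonneg less_irrefl of_nat_0_le_iff plus_complex.sel(1) Re_complex_of_real zero_complex.sel(1))
  have pk: "p ^ k = p * p ^ (k - 1)" using k by (simp add: power_eq_if)
  have eq: "herglotz_term k (n, q) z
      = inverse (of_nat (Suc q)) / p ^ (k - 1) + (- 1 / p ^ k) * (1 / (z + a))" if "Re z > 0" for z
  proof -
    have e: "p * z + of_nat q = p * (z + a)" using p by (simp add: a_def distrib_left)
    show ?thesis unfolding herglotz_term_def prod.case p_def[symmetric] e pk
      using p nz[OF that] by (simp add: divide_simps del: of_nat_Suc)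
  qed
  define S where "S = {z. Re z > 0}"
  have S: "open S" "x \<in> S" "y \<in> S" using x y by (auto simp: S_def open_halfspace_Re_gt)
  have ev: "eventually (\<lambda>z. z \<in> S) (nhds w)" if "w \<in> S" for w
    using S(1) that by (rule eventually_nhds_in_open)
  have "diff_op (k - 1) (herglotz_term k (n, q)) x y
     = diff_op (k - 1) (\<lambda>z. inverse (of_nat (Suc q)) / p ^ (k - 1) + (- 1 / p ^ k) * (1 / (z + a))) x y"
    by (rule diff_op_cong; rule eventually_mono[OF ev]) (use eq S in \<open>auto simp: S_def\<close>)
  also have "\<dots> = (- 1 / p ^ k) * diff_op (k - 1) (\<lambda>z. 1 / (z + a)) x y"
    by (rule diff_op_affine[OF S]) (use nz in \<open>auto intro!: holomorphic_intros simp: S_def\<close>)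
  also have "\<dots> = (- 1 / p ^ k) * ((-1) ^ (k - 1) * (y - x) ^ k / ((x + a) * (y + a)) ^ k)"
    using diff_op_shifted_inverse[OF nz[OF x] nz[OF y] xy, of "k - 1"] k by simp
  also have "\<dots> = (x - y) ^ k / (p * ((x + a) * (y + a))) ^ k"
  proof -
    have "(x - y) ^ k = - ((-1) ^ (k - 1) * (y - x) ^ k)"
      using k power_minus[of "y - x" k] by (cases k) auto
    then show ?thesis by (simp add: power_mult_distrib)
  qed
  also have "\<dots> = (p / (1 / (x - y) * (of_nat q + p * x) * (of_nat q + p * y))) ^ k"
  proof -
    have e: "of_nat q + p * z = p * (z + a)" for z using p by (simp add: a_def distrib_left)
    have "(x - y) / (p * ((x + a) * (y + a))) = p / (1 / (x - y) * (of_nat q + p * x) * (of_nat q + p * y))"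
      unfolding e using p xy nz[OF x] nz[OF y] by (simp add: divide_simps)
    then show ?thesis by (metis power_divide)
  qed
  finally show ?thesis unfolding p_def .
qed

text \<open>The term-by-term argument is carried out on the part of a half-plane $\mathrm{Re}\, z > a > 0$
  inside a disc containing both points, where the majorant of the terms is uniform.\<close>

lemma diff_op_herglotz:
  assumes x: "Re x > 0" and y: "Re y > 0" and xy: "x \<noteq> y" and k: "k \<ge> 3"
  shows "((\<lambda>(p, q). (of_nat p / (1 / (x - y) * (of_nat q + of_nat p * x) * (of_nat q + of_nat p * y))) ^ k)
            has_sum diff_op (k - 1) (herglotz k) x y) ({1..} \<times> UNIV)"
proof -
  define a where "a = min 1 (min (Re x) (Re y) / 2)"
  define R where "R = norm x + norm y + 1"
  define S where "S = {z. Re z > a} \<inter> ball 0 R"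
  have a: "0 < a" "a \<le> 1" using x y by (auto simp: a_def)
  have "open S" unfolding S_def by (intro open_Int open_halfspace_Re_gt open_ball)
  moreover have "x \<in> S" "y \<in> S"
    using x y unfolding S_def a_def R_def by (auto simp: min_less_iff_disj add_nonneg_pos add_pos_nonneg)
  ultimately have S: "open S" "x \<in> S" "y \<in> S" .
  have SR: "Re z > 0" if "z \<in> S" for z using that a by (auto simp: S_def)
  define G where "G = (\<lambda>z. \<Sum>\<^sub>\<infinity>i. herglotz_term k i z)"
  have lim: "uniform_limit S (\<lambda>X z. \<Sum>i\<in>X. herglotz_term k i z) G (finite_subsets_at_top UNIV)"
    unfolding G_def
  proof (rule Weierstrass_m_test_general)
    show "norm (herglotz_term k i z) \<le> (case i of (n, q) \<Rightarrow>
       (R + 1) / a * (real (Suc n) powr (-3/2) * real (Suc q) powr (-3/2)))" if "z \<in> S" for i z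
    proof -
      have "a \<le> Re z" "norm z \<le> R" using that by (auto simp: S_def)
      from norm_herglotz_term_le[OF a this k] show ?thesis by (auto split: prod.splits)
    qed
  qed (rule summable_powr_grid)
  have holo: "herglotz_term k i holomorphic_on S" for i
  proof -
    obtain n q where i: "i = (n, q)" by fastforce
    have "of_nat (Suc n) * z + of_nat q \<noteq> (0::complex)" if "z \<in> S" for z
    proof
      assume *: "of_nat (Suc n) * z + of_nat q = (0::complex)"
      have "Re (of_nat (Suc n) * z + of_nat q) = real (Suc n) * Re z + real q" by simp
      moreover have "real (Suc n) * Re z > 0" using SR[OF that] by simp
      ultimately show False using * by (metis add_pos_nonneg less_irrefl of_nat_0_le_iff zero_complex.sel(1))
    qed
    then show ?thesis unfolding i herglotz_term_def prod.case
      by (intro holomorphic_intros) (auto simp del: of_nat_Suc)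
  qed
  have hG: "G holomorphic_on S"
  proof (rule analytic_imp_holomorphic, unfold analytic_on_def, intro ballI)
    fix z assume "z \<in> S"
    then obtain r where r: "r > 0" "cball z r \<subseteq> S" using S(1) open_contains_cball by blast
    have h: "(\<lambda>z. \<Sum>i\<in>X. herglotz_term k i z) holomorphic_on S" for X
      by (intro holomorphic_intros holo)
    show "\<exists>r>0. G holomorphic_on ball z r"
    proof (rule holomorphic_uniform_limit)
      show "eventually (\<lambda>X. continuous_on (cball z r) (\<lambda>z. \<Sum>i\<in>X. herglotz_term k i z) \<and>
          (\<lambda>z. \<Sum>i\<in>X. herglotz_term k i z) holomorphic_on ball z r) (finite_subsets_at_top UNIV)"
        using holomorphic_on_subset[OF h] r(2) holomorphic_on_imp_continuous_on[OF h] continuous_on_subset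
        by (intro always_eventually allI conjI) (blast, meson ball_subset_cball order_trans)
      show "uniform_limit (cball z r) (\<lambda>X z. \<Sum>i\<in>X. herglotz_term k i z) G (finite_subsets_at_top UNIV)"
        by (rule uniform_limit_on_subset[OF lim r(2)])
    qed (use r(1) in auto)
  qed
  have "((\<lambda>i. diff_op (k - 1) (herglotz_term k i) x y) has_sum diff_op (k - 1) G x y) UNIV"
    by (rule has_sum_diff_op[OF S holo lim])
  also have "diff_op (k - 1) G x y = diff_op (k - 1) (herglotz k) x y"
  proof -
    define C where "C = - of_real euler_mascheroni * (\<Sum>n. 1 / of_nat (Suc n) ^ (k - 1) :: complex)"
    have ev: "eventually (\<lambda>z. z \<in> S) (nhds w)" if "w \<in> S" for w
      using S(1) that by (rule eventually_nhds_in_open)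
    have "diff_op (k - 1) (herglotz k) x y = diff_op (k - 1) (\<lambda>z. C + 1 * G z) x y"
      by (rule diff_op_cong; rule eventually_mono[OF ev])
        (use herglotz_eq_infsum k SR S in \<open>auto simp: C_def G_def\<close>)
    then show ?thesis using diff_op_affine[OF S hG, of "k - 1" C 1] by simp
  qed
  finally have "((\<lambda>(n, q). (of_nat (Suc n) / (1 / (x - y) * (of_nat q + of_nat (Suc n) * x) * (of_nat q + of_nat (Suc n) * y))) ^ k)
      has_sum diff_op (k - 1) (herglotz k) x y) UNIV"
    by (rule has_sum_cong[THEN iffD1, rotated]) (use diff_op_herglotz_term[OF x y xy] k in auto)
  then show ?thesis
    by (subst has_sum_reindex_bij_witness[where S = "{1..} \<times> UNIV" and T = UNIV
          and i = "\<lambda>(n, q). (Suc n, q)" and j = "\<lambda>(p, q). (p - 1, q)"]) auto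
qed

section \<open>Real quadratic fields and their conjugation\<close>

text \<open>Concretely presented, a real quadratic field is $\mathbb{Q}(\sqrt{d})$, with \<open>\<theta>\<close> the positive
  root.  The number \<open>\<theta>\<close> is integral, but $\mathbb{Z}[\theta]$ need not be the maximal order.\<close>

locale quadratic_generator =
  fixes K :: "real set" and \<theta> :: real and d :: int
  assumes theta_pos: "\<theta> > 0" and theta_sq: "\<theta> * \<theta> = of_int d" and theta_irrational: "\<theta> \<notin> \<rat>"
    and K_eq: "K = {a + b * \<theta> | a b. a \<in> \<rat> \<and> b \<in> \<rat>}"

text \<open>Any irrational \<open>x\<close> in the field forms a basis with \<open>1\<close>.  Completing the square in the
  quadratic relation satisfied by \<open>x\<close> and clearing the denominator yields the generator.\<close>

lemma real_quadratic_field_imp_generator: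
  assumes "real_quadratic_field K"
  shows "\<exists>\<theta> d. quadratic_generator K \<theta> d"
proof -
  interpret vs: vector_space "\<lambda>(c::rat) (x::real). of_rat c * x"
    by unfold_locales (auto simp: algebra_simps of_rat_add of_rat_mult)
  from assms have one: "1 \<in> K" and diff: "\<And>x y. x \<in> K \<Longrightarrow> y \<in> K \<Longrightarrow> x - y \<in> K"
    and mult: "\<And>x y. x \<in> K \<Longrightarrow> y \<in> K \<Longrightarrow> x * y \<in> K" and inv: "\<And>x. x \<in> K \<Longrightarrow> inverse x \<in> K"
    and dim: "vs.dim K = 2"
    unfolding real_quadratic_field_def by auto
  have zero: "0 \<in> K" using diff[OF one one] by simp
  have add: "x + y \<in> K" if "x \<in> K" "y \<in> K" for x y
    using diff[OF that(1) diff[OF zero that(2)]] by simp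
  have nat: "of_nat n \<in> K" for n by (induction n) (auto intro: add one zero)
  have int: "of_int n \<in> K" for n
    using nat[of "nat n"] diff[OF zero nat[of "nat (- n)"]] by (cases "n \<ge> 0") auto
  have rat: "r \<in> K" if "r \<in> \<rat>" for r
    using that
  proof (cases rule: Rats_cases')
    case (1 a b)
    then show ?thesis using mult[OF int[of a] inv[OF int[of b]]] by (simp add: divide_inverse)
  qed
  obtain B where B: "B \<subseteq> K" "vs.independent B" "K \<subseteq> vs.span B" "card B = 2"
    using vs.basis_exists[of K] dim by metis
  then have "finite B" using card.infinite by force
  have sp1: "vs.span {1} = \<rat>"
    by (auto simp: vs.span_singleton Rats_def)
  obtain x where x: "x \<in> K" "x \<notin> \<rat>"
  proof (rule ccontr)
    assume "\<not> thesis"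
    then have "K \<subseteq> vs.span {1}" using that sp1 by blast
    then have "vs.dim K \<le> card {1::real}" by (rule vs.dim_le_card) simp
    then show False using dim by simp
  qed
  have x1: "x \<noteq> 1" using x by auto
  have ind1: "vs.independent {1, x}"
  proof -
    have "vs.independent {1}" by simp
    then have "vs.independent (insert x {1})" using x sp1 by (metis vs.independent_insertI)
    then show ?thesis by (simp add: insert_commute)
  qed
  have rep: "\<exists>a\<in>\<rat>. \<exists>b\<in>\<rat>. y = a + b * x" if y: "y \<in> K" for y
  proof -
    have "y \<in> vs.span {1, x}"
    proof (rule ccontr)
      assume ny: "y \<notin> vs.span {1, x}"
      then have "vs.independent (insert y {1, x})" using ind1 by (rule vs.independent_insertI)
      moreover have "insert y {1, x} \<subseteq> vs.span B" using y x one B(3) by auto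
      ultimately have "card (insert y {1, x}) \<le> card B"
        using vs.independent_span_bound[OF \<open>finite B\<close>] by blast
      moreover have "y \<noteq> 1" "y \<noteq> x" using ny vs.span_base by blast+
      ultimately show False using B(4) x1 by simp
    qed
    then have "y \<in> vs.span (insert x {1})" by (simp add: insert_commute)
    then obtain k where "y - of_rat k * x \<in> \<rat>"
      using vs.span_breakdown_eq sp1 by blast
    then show ?thesis
      by (intro bexI[of _ "y - of_rat k * x"] bexI[of _ "of_rat k"]) auto
  qed
  obtain a b where ab: "a \<in> \<rat>" "b \<in> \<rat>" "x * x = a + b * x" using rep[OF mult[OF x(1) x(1)]] by auto
  define e where "e = a + b * b / 4"
  have e: "e \<in> \<rat>" using ab by (auto simp: e_def)
  have e': "(x - b / 2) * (x - b / 2) = e" using ab(3) by (simp add: e_def field_simps)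
  from e obtain m n where mn: "n > 0" "e = of_int m / of_int n" by (cases rule: Rats_cases') auto
  define \<theta> where "\<theta> = of_int n * \<bar>x - b / 2\<bar>"
  have irr: "\<theta> \<notin> \<rat>"
  proof
    assume "\<theta> \<in> \<rat>"
    then have "\<theta> / of_int n \<in> \<rat>" by auto
    then have "\<bar>x - b / 2\<bar> \<in> \<rat>" using mn by (simp add: \<theta>_def)
    then have "x - b / 2 \<in> \<rat>" by (metis Rats_minus_iff abs_if)
    then have "x - b / 2 + b / 2 \<in> \<rat>" using ab(2) by (intro Rats_add) auto
    then show False using x(2) by simp
  qed
  have \<theta>K: "\<theta> \<in> K"
  proof -
    have h: "x - b / 2 \<in> K" using ab by (intro diff x rat) auto
    then have "\<bar>x - b / 2\<bar> \<in> K" using diff[OF zero h] by (auto simp: abs_if)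
    then show ?thesis unfolding \<theta>_def by (intro mult int)
  qed
  have "quadratic_generator K \<theta> (n * m)"
  proof
    show "\<theta> > 0"
    proof -
      have "\<theta> \<ge> 0" using mn by (simp add: \<theta>_def)
      moreover have "\<theta> \<noteq> 0" using irr by auto
      ultimately show ?thesis by simp
    qed
    have "\<theta> * \<theta> = of_int n * of_int n * e" by (simp add: \<theta>_def flip: e')
    also have "\<dots> = of_int (n * m)" using mn by simp
    finally show "\<theta> * \<theta> = of_int (n * m)" .
    show "K = {a + b * \<theta> | a b. a \<in> \<rat> \<and> b \<in> \<rat>}"
    proof (intro equalityI subsetI)
      fix y assume "y \<in> K"
      then obtain r s where rs: "r \<in> \<rat>" "s \<in> \<rat>" "y = r + s * x" using rep by blast
      define t where "t = (if x - b / 2 \<ge> 0 then 1 else -1 :: real)"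
      have "x = b / 2 + t / of_int n * \<theta>" using mn by (auto simp: \<theta>_def t_def)
      then have "y = (r + s * (b / 2)) + (s * (t / of_int n)) * \<theta>"
        using rs by (simp add: algebra_simps)
      moreover have "r + s * (b / 2) \<in> \<rat>" "s * (t / of_int n) \<in> \<rat>"
        using rs ab by (auto simp: t_def)
      ultimately show "y \<in> {a + b * \<theta> | a b. a \<in> \<rat> \<and> b \<in> \<rat>}" by blast
    qed (use \<theta>K rat add mult in auto)
  qed (rule irr)
  then show ?thesis by blast
qed

context quadratic_generator
begin

lemma repr_unique:
  assumes "a \<in> \<rat>" "b \<in> \<rat>" "a' \<in> \<rat>" "b' \<in> \<rat>" "a + b * \<theta> = a' + b' * \<theta>"
  shows "a = a'" "b = b'"
proof -
  have "b = b'"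
  proof (rule ccontr)
    assume "b \<noteq> b'"
    then have "\<theta> = (a' - a) / (b - b')" using assms(5) by (simp add: field_simps)
    then show False using theta_irrational assms by auto
  qed
  then show "a = a'" "b = b'" using assms(5) by auto
qed

lemma K_cases:
  assumes "x \<in> K"
  obtains a b where "a \<in> \<rat>" "b \<in> \<rat>" "x = a + b * \<theta>"
  using assms unfolding K_eq by blast

lemma K_intro: "a \<in> \<rat> \<Longrightarrow> b \<in> \<rat> \<Longrightarrow> a + b * \<theta> \<in> K"
  unfolding K_eq by blast

lemma mult_repr: "(a + b * \<theta>) * (a' + b' * \<theta>) = (a * a' + b * b' * of_int d) + (a * b' + b * a') * \<theta>"
proof -
  have "(a + b * \<theta>) * (a' + b' * \<theta>) = a * a' + b * b' * (\<theta> * \<theta>) + (a * b' + b * a') * \<theta>"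
    by (simp add: algebra_simps)
  then show ?thesis by (simp add: theta_sq)
qed

lemma K_rat: "r \<in> \<rat> \<Longrightarrow> r \<in> K" using K_intro[of r 0] by simp

lemma K_theta: "\<theta> \<in> K" using K_intro[of 0 1] by simp

lemma K_add: "x \<in> K \<Longrightarrow> y \<in> K \<Longrightarrow> x + y \<in> K"
proof (elim K_cases)
  fix a b a' b' assume *: "a \<in> \<rat>" "b \<in> \<rat>" "a' \<in> \<rat>" "b' \<in> \<rat>" "x = a + b * \<theta>" "y = a' + b' * \<theta>"
  then have "x + y = (a + a') + (b + b') * \<theta>" by (simp add: algebra_simps)
  then show "x + y \<in> K" using * K_intro Rats_add by metis
qed

lemma K_mult: "x \<in> K \<Longrightarrow> y \<in> K \<Longrightarrow> x * y \<in> K"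
proof (elim K_cases)
  fix a b a' b' assume *: "a \<in> \<rat>" "b \<in> \<rat>" "a' \<in> \<rat>" "b' \<in> \<rat>" "x = a + b * \<theta>" "y = a' + b' * \<theta>"
  show "x * y \<in> K" unfolding * mult_repr using * by (intro K_intro) auto
qed

lemma K_diff: "x \<in> K \<Longrightarrow> y \<in> K \<Longrightarrow> x - y \<in> K"
  using K_add[of x "-1 * y"] K_mult[of "-1" y] K_rat[of "-1"] by simp

text \<open>This identifies the definite description behind the conjugation.  The map
  $a + b\theta \mapsto a - b\theta$ is a nontrivial automorphism; conversely every automorphism fixes
  the rationals and permutes the roots of $X^2 - d$, so a nontrivial one must negate \<open>\<theta>\<close>.\<close>

lemma galois_conj_repr:
  assumes "a \<in> \<rat>" "b \<in> \<rat>"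
  shows "galois_conj K (a + b * \<theta>) = a - b * \<theta>"
proof -
  define g where "g = (\<lambda>x. THE z. \<exists>a b. a \<in> \<rat> \<and> b \<in> \<rat> \<and> x = a + b * \<theta> \<and> z = a - b * \<theta>)"
  have g: "g (a + b * \<theta>) = a - b * \<theta>" if "a \<in> \<rat>" "b \<in> \<rat>" for a b
    unfolding g_def
  proof (rule the_equality)
    fix z assume "\<exists>a' b'. a' \<in> \<rat> \<and> b' \<in> \<rat> \<and> a + b * \<theta> = a' + b' * \<theta> \<and> z = a' - b' * \<theta>"
    then show "z = a - b * \<theta>" using repr_unique[OF that] by metis
  qed (use that in blast)
  define h where "h = restrict g K"
  have h: "h (a + b * \<theta>) = a - b * \<theta>" if "a \<in> \<rat>" "b \<in> \<rat>" for a b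
    using g[OF that] K_intro[OF that] by (simp add: h_def)
  have hK: "h x \<in> K" "h (h x) = x" if x: "x \<in> K" for x
  proof -
    obtain a b where ab: "a \<in> \<rat>" "b \<in> \<rat>" "x = a + b * \<theta>" by (rule K_cases[OF x])
    have 1: "h x = a + (- b) * \<theta>" using h ab by simp
    then show "h x \<in> K" using K_intro[of a "- b"] ab by simp
    show "h (h x) = x" unfolding 1 using ab by (subst h) auto
  qed
  have hom: "h (x + y) = h x + h y \<and> h (x * y) = h x * h y" if x: "x \<in> K" "y \<in> K" for x y
  proof -
    obtain a b where ab: "a \<in> \<rat>" "b \<in> \<rat>" "x = a + b * \<theta>" by (rule K_cases[OF x(1)])
    obtain a' b' where ab': "a' \<in> \<rat>" "b' \<in> \<rat>" "y = a' + b' * \<theta>" by (rule K_cases[OF x(2)])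
    have "x + y = (a + a') + (b + b') * \<theta>" using ab ab' by (simp add: algebra_simps)
    then have 1: "h (x + y) = (a + a') - (b + b') * \<theta>"
      using h[OF Rats_add[OF ab(1) ab'(1)] Rats_add[OF ab(2) ab'(2)]] by simp
    have "h (x * y) = (a * a' + b * b' * of_int d) - (a * b' + b * a') * \<theta>"
      unfolding ab(3) ab'(3) mult_repr using ab ab' by (intro h) auto
    also have "\<dots> = (a + (- b) * \<theta>) * (a' + (- b') * \<theta>)" unfolding mult_repr by (simp add: algebra_simps)
    also have "\<dots> = h x * h y" using h ab ab' by simp
    finally have 2: "h (x * y) = h x * h y" .
    have "h (x + y) = h x + h y" unfolding 1 using h ab ab' by (simp add: distrib_right)
    with 2 show ?thesis by simp
  qed
  have "(THE \<sigma>. \<sigma> \<in> extensional K \<and> field_automorphism K \<sigma> \<and> (\<exists>x\<in>K. \<sigma> x \<noteq> x)) = h"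
  proof (rule the_equality, intro conjI)
    show "h \<in> extensional K" by (simp add: h_def)
    show "field_automorphism K h"
      unfolding field_automorphism_def
      using hom hK by (auto intro!: bij_betw_byWitness[of _ h])
    show "\<exists>x\<in>K. h x \<noteq> x"
      using h[of 0 1] K_theta theta_pos by (intro bexI[of _ \<theta>]) auto
  next
    fix \<sigma> assume \<sigma>: "\<sigma> \<in> extensional K \<and> field_automorphism K \<sigma> \<and> (\<exists>x\<in>K. \<sigma> x \<noteq> x)"
    then have add: "\<And>x y. x \<in> K \<Longrightarrow> y \<in> K \<Longrightarrow> \<sigma> (x + y) = \<sigma> x + \<sigma> y"
      and mult: "\<And>x y. x \<in> K \<Longrightarrow> y \<in> K \<Longrightarrow> \<sigma> (x * y) = \<sigma> x * \<sigma> y"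
      and inj: "inj_on \<sigma> K"
      unfolding field_automorphism_def bij_betw_def by auto
    have z: "0 \<in> K" "1 \<in> K" by (auto intro: K_rat)
    have s0: "\<sigma> 0 = 0" using add[OF z(1) z(1)] by simp
    have s1: "\<sigma> 1 = 1"
      using mult[OF z(2) z(2)] s0 inj_onD[OF inj _ z(2) z(1)] by (metis mult_cancel_left2 mult_1 zero_neq_one)
    have snat: "\<sigma> (of_nat n) = of_nat n" for n
      by (induction n) (use add[OF z(2) K_rat] s0 s1 in auto)
    have sint: "\<sigma> (of_int n) = of_int n" for n
    proof (cases "n \<ge> 0")
      case True then show ?thesis using snat[of "nat n"] by simp
    next
      case False
      have "\<sigma> (of_int n + of_nat (nat (- n))) = \<sigma> (of_int n) + of_nat (nat (- n))"
        using add[OF K_rat K_rat, of "of_int n" "of_nat (nat (- n))"] snat by simp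
      then show ?thesis using False s0 by simp
    qed
    have srat: "\<sigma> r = r" if "r \<in> \<rat>" for r
      using that
    proof (cases rule: Rats_cases')
      case (1 m n)
      have "\<sigma> (of_int n * r) = of_int n * \<sigma> r"
        using mult[OF K_rat K_rat, of "of_int n" r] sint that by simp
      moreover have "of_int n * r = of_int m" using 1 by simp
      ultimately have "of_int n * \<sigma> r = of_int m" using sint by simp
      then have "\<sigma> r = of_int m / of_int n" using 1(1) by (simp add: field_simps)
      then show ?thesis using 1(3) by simp
    qed
    have srep: "\<sigma> (a + b * \<theta>) = a + b * \<sigma> \<theta>" if "a \<in> \<rat>" "b \<in> \<rat>" for a b
      using add[OF K_rat[OF that(1)] K_mult[OF K_rat[OF that(2)] K_theta]]
        mult[OF K_rat[OF that(2)] K_theta] srat that by simp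
    have "\<sigma> \<theta> * \<sigma> \<theta> = \<theta> * \<theta>" using mult[OF K_theta K_theta] theta_sq sint by simp
    then have "\<sigma> \<theta> = \<theta> \<or> \<sigma> \<theta> = - \<theta>" by (simp add: square_eq_iff)
    moreover have "\<sigma> \<theta> \<noteq> \<theta>"
    proof
      assume "\<sigma> \<theta> = \<theta>"
      then have "\<sigma> x = x" if "x \<in> K" for x using srep that by (auto elim!: K_cases)
      then show False using \<sigma> by blast
    qed
    ultimately have st: "\<sigma> \<theta> = - \<theta>" by simp
    show "\<sigma> = h"
    proof (rule extensionalityI[of _ K])
      fix x assume "x \<in> K"
      then show "\<sigma> x = h x" using srep h st by (auto elim!: K_cases)
    qed (use \<sigma> in \<open>auto simp: h_def\<close>)
  qed
  then show ?thesis unfolding galois_conj_def using h assms by simp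
qed

abbreviation conj :: "real \<Rightarrow> real" where "conj \<equiv> galois_conj K"

lemma conj_in_K: "x \<in> K \<Longrightarrow> conj x \<in> K"
  using K_intro[of _ "- _"] by (auto elim!: K_cases simp: galois_conj_repr)

lemma conj_conj: "x \<in> K \<Longrightarrow> conj (conj x) = x"
  using galois_conj_repr[of _ "- _"] by (auto elim!: K_cases simp: galois_conj_repr)

lemma conj_rat: "r \<in> \<rat> \<Longrightarrow> conj r = r"
  using galois_conj_repr[of r 0] by simp

lemma conj_theta: "conj \<theta> = - \<theta>" using galois_conj_repr[of 0 1] by simp

lemma conj_add: "x \<in> K \<Longrightarrow> y \<in> K \<Longrightarrow> conj (x + y) = conj x + conj y"
proof (elim K_cases)
  fix a b a' b' assume *: "a \<in> \<rat>" "b \<in> \<rat>" "a' \<in> \<rat>" "b' \<in> \<rat>" "x = a + b * \<theta>" "y = a' + b' * \<theta>"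
  then have "x + y = (a + a') + (b + b') * \<theta>" by (simp add: algebra_simps)
  then have "conj (x + y) = (a + a') - (b + b') * \<theta>"
    using galois_conj_repr[OF Rats_add[OF *(1) *(3)] Rats_add[OF *(2) *(4)]] by simp
  then show "conj (x + y) = conj x + conj y" using *
    by (simp add: galois_conj_repr distrib_right)
qed

lemma conj_mult: "x \<in> K \<Longrightarrow> y \<in> K \<Longrightarrow> conj (x * y) = conj x * conj y"
proof (elim K_cases)
  fix a b a' b' assume *: "a \<in> \<rat>" "b \<in> \<rat>" "a' \<in> \<rat>" "b' \<in> \<rat>" "x = a + b * \<theta>" "y = a' + b' * \<theta>"
  have "conj (x * y) = (a * a' + b * b' * of_int d) - (a * b' + b * a') * \<theta>"
    unfolding * mult_repr using * by (intro galois_conj_repr) auto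
  also have "\<dots> = (a + (- b) * \<theta>) * (a' + (- b') * \<theta>)" unfolding mult_repr by (simp add: algebra_simps)
  finally show "conj (x * y) = conj x * conj y" using * by (simp add: galois_conj_repr)
qed

lemma conj_diff: "x \<in> K \<Longrightarrow> y \<in> K \<Longrightarrow> conj (x - y) = conj x - conj y"
  using conj_add[OF K_diff] by (metis add_diff_cancel_right' diff_add_cancel)

lemma trace_norm_rat: "x \<in> K \<Longrightarrow> x + conj x \<in> \<rat>" "x \<in> K \<Longrightarrow> x * conj x \<in> \<rat>"
proof -
  assume "x \<in> K"
  then obtain a b where ab: "a \<in> \<rat>" "b \<in> \<rat>" "x = a + b * \<theta>" by (rule K_cases)
  have c: "conj x = a + (- b) * \<theta>" using ab galois_conj_repr by simp
  show "x + conj x \<in> \<rat>" unfolding c using ab by simp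
  show "x * conj x \<in> \<rat>" unfolding c unfolding ab(3) mult_repr using ab by simp
qed

lemma conj_eq_iff: "x \<in> K \<Longrightarrow> conj x = x \<longleftrightarrow> x \<in> \<rat>"
proof -
  assume "x \<in> K"
  then obtain a b where ab: "a \<in> \<rat>" "b \<in> \<rat>" "x = a + b * \<theta>" by (rule K_cases)
  show ?thesis
  proof
    assume "conj x = x"
    then have "b = 0" using ab theta_pos by (simp add: galois_conj_repr)
    then show "x \<in> \<rat>" using ab by simp
  qed (rule conj_rat)
qed

lemma conj_eq_0: "x \<in> K \<Longrightarrow> conj x = 0 \<longleftrightarrow> x = 0"
  using conj_conj[of x] conj_rat[of 0] by auto

lemma K_inverse: "x \<in> K \<Longrightarrow> inverse x \<in> K"
proof (cases "x = 0")
  case False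
  assume x: "x \<in> K"
  have n: "x * conj x \<noteq> 0" using conj_eq_0[OF x] False by simp
  have "inverse x = conj x * inverse (x * conj x)" using n by (simp add: field_simps)
  moreover have "inverse (x * conj x) \<in> K" using trace_norm_rat(2)[OF x] by (intro K_rat Rats_inverse)
  ultimately show ?thesis using conj_in_K[OF x] K_mult by metis
qed simp

lemma K_divide: "x \<in> K \<Longrightarrow> y \<in> K \<Longrightarrow> x / y \<in> K"
  using K_mult K_inverse by (simp add: divide_inverse)

lemma conj_inverse: "x \<in> K \<Longrightarrow> conj (inverse x) = inverse (conj x)"
proof (cases "x = 0")
  case False
  assume x: "x \<in> K"
  have "conj x * conj (inverse x) = 1"
    using conj_mult[OF x K_inverse[OF x]] False conj_rat[of 1] by simp
  then show ?thesis by (simp add: inverse_unique)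
qed (simp add: conj_rat)

lemma conj_divide: "x \<in> K \<Longrightarrow> y \<in> K \<Longrightarrow> conj (x / y) = conj x / conj y"
  using conj_mult K_inverse conj_inverse by (simp add: divide_inverse)

end

section \<open>Integers and ideals\<close>

text \<open>In lowest terms $a/b$, the power $b^i$ divides \<open>N\<close> for all \<open>i\<close>, which bounds $2^i$ by \<open>N\<close>
  unless $b = 1$.\<close>

lemma int_if_powers_bounded_denominators:
  fixes r :: real
  assumes r: "r \<in> \<rat>" and N: "(N::int) > 0" and pw: "\<And>i. of_int N * r ^ i \<in> \<int>"
  shows "r \<in> \<int>"
  using r
proof (cases rule: Rats_cases')
  case (1 a b)
  have "b = 1"
  proof (rule ccontr)
    assume "b \<noteq> 1"
    then have b: "b \<ge> 2" using 1 by simp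
    define i where "i = nat N"
    obtain c where "of_int N * r ^ i = of_int c" using pw[of i] by (auto elim: Ints_cases)
    then have "of_int N * of_int a ^ i = (of_int c * of_int b ^ i :: real)"
      using 1 b by (simp add: power_divide field_simps)
    then have "N * a ^ i = c * b ^ i" by (metis (mono_tags) of_int_eq_iff of_int_mult of_int_power)
    then have "b ^ i dvd N * a ^ i" by simp
    moreover have "coprime (b ^ i) (a ^ i)" using 1 by (simp add: coprime_commute)
    ultimately have "b ^ i dvd N" by (simp add: coprime_dvd_mult_left_iff)
    then have "b ^ i \<le> N" using N by (rule zdvd_imp_le)
    moreover have "N < 2 ^ i" using of_nat_less_two_power[of i, where 'a=int] N by (simp add: i_def)
    moreover have "(2::int) ^ i \<le> b ^ i" using b by (intro power_mono) auto
    ultimately show False by linarith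
  qed
  then show ?thesis using 1 by simp
qed

context quadratic_generator
begin

text \<open>The order $\mathbb{Z}[\theta]$, which serves as a reference lattice for denominators.\<close>

definition gen_order :: "real set" where
  "gen_order = {of_int m + of_int n * \<theta> | m n. True}"

lemma gen_order_intro: "of_int m + of_int n * \<theta> \<in> gen_order"
  unfolding gen_order_def by blast

lemma gen_order_int: "of_int m \<in> gen_order"
  using gen_order_intro[of m 0] by simp

lemma gen_order_subset_K: "gen_order \<subseteq> K"
  unfolding gen_order_def by (auto intro!: K_intro)

lemma gen_order_add: "x \<in> gen_order \<Longrightarrow> y \<in> gen_order \<Longrightarrow> x + y \<in> gen_order"
  unfolding gen_order_def
proof clarify
  fix m n m' n'
  have "of_int m + of_int n * \<theta> + (of_int m' + of_int n' * \<theta>) = of_int (m + m') + of_int (n + n') * \<theta>"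
    by (simp add: algebra_simps)
  then show "\<exists>k l. of_int m + of_int n * \<theta> + (of_int m' + of_int n' * \<theta>) = of_int k + of_int l * \<theta> \<and> True"
    by blast
qed

lemma gen_order_mult: "x \<in> gen_order \<Longrightarrow> y \<in> gen_order \<Longrightarrow> x * y \<in> gen_order"
  unfolding gen_order_def
proof clarify
  fix m n m' n'
  have "(of_int m + of_int n * \<theta>) * (of_int m' + of_int n' * \<theta>)
      = of_int (m * m' + n * n' * d) + of_int (m * n' + n * m') * \<theta>"
    unfolding mult_repr by simp
  then show "\<exists>k l. (of_int m + of_int n * \<theta>) * (of_int m' + of_int n' * \<theta>) = of_int k + of_int l * \<theta> \<and> True"
    by blast
qed

lemma gen_order_power: "x \<in> gen_order \<Longrightarrow> x ^ i \<in> gen_order"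
  by (induction i) (use gen_order_int[of 1] in \<open>auto intro: gen_order_mult\<close>)

lemma gen_order_sum: "(\<And>a. a \<in> A \<Longrightarrow> f a \<in> gen_order) \<Longrightarrow> sum f A \<in> gen_order"
  by (induction A rule: infinite_finite_induct) (use gen_order_int[of 0] in \<open>auto intro: gen_order_add\<close>)

lemma gen_order_conj: "x \<in> gen_order \<Longrightarrow> conj x \<in> gen_order"
proof -
  assume "x \<in> gen_order"
  then obtain m n where "x = of_int m + of_int n * \<theta>" unfolding gen_order_def by blast
  then show ?thesis using gen_order_intro[of m "- n"] by (simp add: galois_conj_repr)
qed

lemma gen_order_rat: "x \<in> gen_order \<Longrightarrow> x \<in> \<rat> \<Longrightarrow> x \<in> \<int>"
proof -
  assume x: "x \<in> gen_order" "x \<in> \<rat>"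
  from x(1) obtain m n where mn: "x = of_int m + of_int n * \<theta>" unfolding gen_order_def by blast
  have "of_int m = x" by (rule repr_unique(1)[of "of_int m" "of_int n" x 0, OF Rats_of_int Rats_of_int x(2) Rats_0]) (simp add: mn)
  then show "x \<in> \<int>" by (metis Ints_of_int)
qed

text \<open>Integrality in terms of denominators: all powers lie in one lattice
  $\frac{1}{N} \mathbb{Z}[\theta]$.  In this form the closure under sums and products is immediate, and so
  is the integrality of trace and norm.\<close>

definition bounded_powers :: "real \<Rightarrow> bool" where
  "bounded_powers x \<longleftrightarrow> (\<exists>N::int. N > 0 \<and> (\<forall>i. of_int N * x ^ i \<in> gen_order))"

lemma bounded_powersE:
  assumes "bounded_powers x"
  obtains N :: int where "N > 0" "\<And>i. of_int N * x ^ i \<in> gen_order"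
  using assms unfolding bounded_powers_def by blast

lemma bounded_powers_mult:
  assumes "bounded_powers x" "bounded_powers y"
  shows "bounded_powers (x * y)"
proof -
  obtain N where N: "N > 0" "\<And>i. of_int N * x ^ i \<in> gen_order" using assms(1) by (rule bounded_powersE) blast
  obtain M where M: "M > 0" "\<And>i. of_int M * y ^ i \<in> gen_order" using assms(2) by (rule bounded_powersE) blast
  have "of_int (N * M) * (x * y) ^ i \<in> gen_order" for i
    using gen_order_mult[OF N(2) M(2), of i i] by (simp add: power_mult_distrib mult_ac)
  then show ?thesis unfolding bounded_powers_def using N(1) M(1) by (intro exI[of _ "N * M"]) auto
qed

lemma bounded_powers_add:
  assumes "bounded_powers x" "bounded_powers y"
  shows "bounded_powers (x + y)"
proof -
  obtain N where N: "N > 0" "\<And>i. of_int N * x ^ i \<in> gen_order" using assms(1) by (rule bounded_powersE) blast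
  obtain M where M: "M > 0" "\<And>i. of_int M * y ^ i \<in> gen_order" using assms(2) by (rule bounded_powersE) blast
  have "of_int (N * M) * (x + y) ^ i \<in> gen_order" for i
  proof -
    have "of_int (N * M) * (x + y) ^ i
        = (\<Sum>j\<le>i. of_int (int (i choose j)) * ((of_int N * x ^ j) * (of_int M * y ^ (i - j))))"
      by (simp add: binomial_ring sum_distrib_left mult_ac)
    also have "\<dots> \<in> gen_order" by (intro gen_order_sum gen_order_mult gen_order_int N M)
    finally show ?thesis .
  qed
  then show ?thesis unfolding bounded_powers_def using N(1) M(1) by (intro exI[of _ "N * M"]) auto
qed

lemma conj_power: "x \<in> K \<Longrightarrow> conj (x ^ i) = conj x ^ i \<and> x ^ i \<in> K"
  by (induction i) (auto simp: conj_mult K_mult conj_rat K_rat)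

lemma bounded_powers_conj:
  assumes "x \<in> K" "bounded_powers x"
  shows "bounded_powers (conj x)"
proof -
  obtain N where N: "N > 0" "\<And>i. of_int N * x ^ i \<in> gen_order" using assms(2) by (rule bounded_powersE) blast
  have "of_int N * conj x ^ i \<in> gen_order" for i
    using gen_order_conj[OF N(2), of i] conj_power[OF assms(1), of i] by (simp add: conj_mult K_rat conj_rat)
  then show ?thesis unfolding bounded_powers_def using N(1) by blast
qed

lemma bounded_powers_rat:
  assumes "x \<in> \<rat>" "bounded_powers x"
  shows "x \<in> \<int>"
proof -
  obtain N where N: "N > 0" "\<And>i. of_int N * x ^ i \<in> gen_order" using assms(2) by (rule bounded_powersE) blast
  have "x ^ i \<in> \<rat>" for i using assms(1) by simp
  then show ?thesis
    using int_if_powers_bounded_denominators[OF assms(1) N(1)] gen_order_rat[OF N(2)] by simp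
qed

lemma gen_order_bounded: "x \<in> gen_order \<Longrightarrow> bounded_powers x"
  unfolding bounded_powers_def by (rule exI[of _ 1]) (simp add: gen_order_power)

lemma denominator_exists:
  assumes "x \<in> K"
  obtains c :: int where "c > 0" "of_int c * x \<in> gen_order"
proof -
  obtain a b where ab: "a \<in> \<rat>" "b \<in> \<rat>" "x = a + b * \<theta>" using assms by (rule K_cases)
  obtain m n where mn: "n > 0" "a = of_int m / of_int n" using ab(1) by (cases rule: Rats_cases') auto
  obtain k l where kl: "l > 0" "b = of_int k / of_int l" using ab(2) by (cases rule: Rats_cases') auto
  have "of_int (n * l) * x = of_int (m * l) + of_int (k * n) * \<theta>"
    using mn kl unfolding ab(3) by (simp add: field_simps)
  then show ?thesis using that[of "n * l"] gen_order_intro[of "m * l" "k * n"] mn kl by simp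
qed

text \<open>A monic integral relation expresses each high power through lower ones without introducing new
  denominators, so those of $1, x, \dots, x^{n-1}$ suffice.\<close>

lemma algebraic_int_bounded:
  assumes x: "x \<in> K" and "algebraic_int x"
  shows "bounded_powers x"
proof -
  obtain p where p: "lead_coeff p = 1" "\<forall>i. coeff p i \<in> \<int>" "poly p x = 0"
    using assms(2) by (auto elim: algebraic_int.cases)
  obtain c where c: "c > 0" "of_int c * x \<in> gen_order" by (rule denominator_exists[OF x])
  define n where "n = degree p"
  have rel: "x ^ n = - (\<Sum>j<n. coeff p j * x ^ j)"
  proof -
    have "0 = (\<Sum>j\<le>n. coeff p j * x ^ j)" using p(3) by (simp add: poly_altdef n_def)
    also have "{..n} = insert n {..<n}" by auto
    also have "(\<Sum>j\<in>insert n {..<n}. coeff p j * x ^ j) = x ^ n + (\<Sum>j<n. coeff p j * x ^ j)"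
      using p(1) by (simp add: n_def)
    finally show ?thesis by linarith
  qed
  have "of_int (c ^ n) * x ^ i \<in> gen_order" for i
  proof (induction i rule: less_induct)
    case (less i)
    show ?case
    proof (cases "i < n")
      case True
      then have "of_int (c ^ n) * x ^ i = of_int (c ^ (n - i)) * (of_int c * x) ^ i"
        by (simp add: power_mult_distrib flip: mult.assoc power_add)
      then show ?thesis using gen_order_mult[OF gen_order_int[of "c ^ (n - i)"] gen_order_power[OF c(2)]] by simp
    next
      case False
      then have "x ^ i = x ^ (i - n) * x ^ n" by (simp flip: power_add)
      also have "\<dots> = (\<Sum>j<n. - coeff p j * x ^ (i - n + j))"
        unfolding rel by (simp add: sum_distrib_left power_add mult_ac flip: sum_negf)
      finally have "of_int (c ^ n) * x ^ i = (\<Sum>j<n. - coeff p j * (of_int (c ^ n) * x ^ (i - n + j)))"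
        by (simp add: sum_distrib_left mult_ac)
      also have "\<dots> \<in> gen_order"
      proof (rule gen_order_sum, rule gen_order_mult)
        fix j assume j: "j \<in> {..<n}"
        have "- coeff p j \<in> \<int>" using p(2) by simp
        then show "- coeff p j \<in> gen_order" using gen_order_int by (metis Ints_cases)
        show "of_int (c ^ n) * x ^ (i - n + j) \<in> gen_order" using j False by (intro less.IH) auto
      qed
      finally show ?thesis .
    qed
  qed
  then show ?thesis unfolding bounded_powers_def using c(1) by (intro exI[of _ "c ^ n"]) auto
qed

lemma bounded_trace_norm:
  assumes "x \<in> K" "bounded_powers x"
  shows "x + conj x \<in> \<int>" "x * conj x \<in> \<int>"
  using bounded_powers_rat[OF trace_norm_rat(1)[OF assms(1)]] bounded_powers_rat[OF trace_norm_rat(2)[OF assms(1)]]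
    bounded_powers_add[OF assms(2) bounded_powers_conj[OF assms]]
    bounded_powers_mult[OF assms(2) bounded_powers_conj[OF assms]] by simp_all

text \<open>For the converse direction, bounded powers make trace and norm rational numbers with bounded
  powers, hence integers, and \<open>x\<close> is a root of $X^2 - \mathrm{tr}(x) X + N(x)$.\<close>

lemma ring_of_integers_iff: "x \<in> ring_of_integers K \<longleftrightarrow> x \<in> K \<and> bounded_powers x"
proof
  assume "x \<in> K \<and> bounded_powers x"
  then have x: "x \<in> K" and tn: "x + conj x \<in> \<int>" "x * conj x \<in> \<int>" using bounded_trace_norm by auto
  define p where "p = [:x * conj x, - (x + conj x), 1:]"
  have "algebraic_int x"
  proof (rule algebraic_int.intros)
    show "lead_coeff p = 1" by (simp add: p_def)
    have "- (x + conj x) \<in> \<int>" using tn(1) by (rule Ints_minus)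
    then show "\<forall>i. coeff p i \<in> \<int>" using tn(2) by (auto simp: p_def coeff_pCons split: nat.splits)
    show "poly p x = 0" by (simp add: p_def algebra_simps)
  qed
  then show "x \<in> ring_of_integers K" using x by (simp add: ring_of_integers_def)
qed (auto simp: ring_of_integers_def algebraic_int_bounded)

lemma ring_of_integers_mult:
  "x \<in> ring_of_integers K \<Longrightarrow> y \<in> ring_of_integers K \<Longrightarrow> x * y \<in> ring_of_integers K"
  by (simp add: ring_of_integers_iff K_mult bounded_powers_mult)

lemma ring_of_integers_gen_order: "x \<in> gen_order \<Longrightarrow> x \<in> ring_of_integers K"
  using ring_of_integers_iff gen_order_bounded gen_order_subset_K by blast

lemma ring_of_integers_int: "of_int m \<in> ring_of_integers K"
  using ring_of_integers_gen_order gen_order_int by blast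

lemma ring_of_integers_theta: "\<theta> \<in> ring_of_integers K"
  using ring_of_integers_gen_order gen_order_intro[of 0 1] by simp

lemma ring_of_integers_conj: "x \<in> ring_of_integers K \<Longrightarrow> conj x \<in> ring_of_integers K"
  by (simp add: ring_of_integers_iff conj_in_K bounded_powers_conj)

lemma ring_of_integers_trace_norm:
  "x \<in> ring_of_integers K \<Longrightarrow> x + conj x \<in> \<int>" "x \<in> ring_of_integers K \<Longrightarrow> x * conj x \<in> \<int>"
  using ring_of_integers_iff bounded_trace_norm by auto

lemma ideal_in_K: "I \<in> ideals K \<Longrightarrow> x \<in> I \<Longrightarrow> x \<in> K"
  and ideal_diff: "I \<in> ideals K \<Longrightarrow> x \<in> I \<Longrightarrow> y \<in> I \<Longrightarrow> x - y \<in> I"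
  and ideal_mult: "I \<in> ideals K \<Longrightarrow> a \<in> ring_of_integers K \<Longrightarrow> x \<in> I \<Longrightarrow> a * x \<in> I"
  unfolding ideals_def by auto

lemma ideal_int_combination:
  assumes "I \<in> ideals K" "x \<in> I" "y \<in> I"
  shows "of_int m * x + of_int n * y \<in> I"
  using ideal_diff[OF assms(1) ideal_mult[OF assms(1) ring_of_integers_int[of m] assms(2)]
      ideal_mult[OF assms(1) ring_of_integers_int[of "- n"] assms(3)]]
  by simp

text \<open>The norm of a common denominator is again one, and it is a rational integer.  Traces and norms
  of the elements of an ideal therefore take values in a discrete set.\<close>

lemma ideal_denominator:
  assumes "I \<in> ideals K"
  obtains m :: int where "m > 0" "\<And>x. x \<in> I \<Longrightarrow> of_int m * x \<in> ring_of_integers K"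
proof -
  have "\<exists>e\<in>ring_of_integers K. e \<noteq> 0 \<and> (\<forall>x\<in>I. e * x \<in> ring_of_integers K)"
    using assms unfolding ideals_def by blast
  then obtain e where e: "e \<in> ring_of_integers K" "e \<noteq> 0" "\<And>x. x \<in> I \<Longrightarrow> e * x \<in> ring_of_integers K"
    by blast
  obtain n where n: "e * conj e = of_int n" using ring_of_integers_trace_norm(2)[OF e(1)] by (auto elim: Ints_cases)
  have "n \<noteq> 0" using n e conj_eq_0[of e] by (auto simp: ring_of_integers_def)
  moreover have "of_int \<bar>n\<bar> * x \<in> ring_of_integers K" if "x \<in> I" for x
  proof -
    have "of_int (sgn n) * (conj e * (e * x)) \<in> ring_of_integers K"
      by (intro ring_of_integers_mult ring_of_integers_int ring_of_integers_conj e that)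
    also have "of_int (sgn n) * (conj e * (e * x)) = of_int (sgn n) * of_int n * x"
      unfolding n[symmetric] by simp
    also have "\<dots> = of_int \<bar>n\<bar> * x" by (simp add: abs_sgn mult.commute)
    finally show ?thesis .
  qed
  ultimately show ?thesis using that[of "\<bar>n\<bar>"] by simp
qed

lemma ideal_scale:
  assumes I: "I \<in> ideals K" and c: "c \<in> K" "c \<noteq> 0"
  shows "(\<lambda>x. c * x) ` I \<in> ideals K"
proof -
  obtain m where m: "m > 0" "\<And>x. x \<in> I \<Longrightarrow> of_int m * x \<in> ring_of_integers K"
    by (rule ideal_denominator[OF I]) blast
  obtain n where n: "n > 0" "of_int n * c \<in> gen_order" by (rule denominator_exists[OF c(1)])
  have "of_int (n * m) * (c * x) \<in> ring_of_integers K" if "x \<in> I" for x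
    using ring_of_integers_mult[OF ring_of_integers_gen_order[OF n(2)] m(2)[OF that]] by (simp add: mult_ac)
  moreover have "of_int (n * m) \<noteq> (0::real)" using n m by simp
  moreover have "0 \<in> I" using I by (simp add: ideals_def)
  moreover obtain x where "x \<in> I" "x \<noteq> 0" using I \<open>0 \<in> I\<close> by (auto simp: ideals_def)
  ultimately show ?thesis
    unfolding ideals_def
    apply (intro CollectI conjI)
    subgoal using I c by (auto intro: K_mult dest: ideal_in_K)
    subgoal using c \<open>x \<in> I\<close> \<open>x \<noteq> 0\<close> by (metis imageI mult_eq_0_iff singletonD)
    subgoal by auto
    subgoal using ideal_diff[OF I] by (auto simp flip: right_diff_distrib)
    subgoal using ideal_mult[OF I] by (auto simp: mult.left_commute)
    subgoal using ring_of_integers_int[of "n * m"] by (intro bexI[of _ "of_int (n * m)"]) auto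
    done
qed

abbreviation totally_positive :: "real \<Rightarrow> bool" where
  "totally_positive x \<equiv> x > 0 \<and> conj x > 0"

lemma class_nonempty:
  assumes "B \<in> narrow_ideal_classes K"
  obtains I where "I \<in> B" "I \<in> ideals K"
proof -
  obtain I where I: "I \<in> ideals K" "B = narrow_equiv K `` {I}"
    using assms unfolding narrow_ideal_classes_def by (auto elim: quotientE)
  have "(I, I) \<in> narrow_equiv K"
    unfolding narrow_equiv_def using I(1) by (auto intro!: bexI[of _ 1] K_rat simp: conj_rat)
  then show ?thesis using that I by blast
qed

lemma class_ideal: "B \<in> narrow_ideal_classes K \<Longrightarrow> I \<in> B \<Longrightarrow> I \<in> ideals K"
  unfolding narrow_ideal_classes_def narrow_equiv_def by (auto elim!: quotientE)

lemma class_scale: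
  assumes B: "B \<in> narrow_ideal_classes K" and I: "I \<in> B" and c: "c \<in> K" "totally_positive c"
  shows "(\<lambda>x. c * x) ` I \<in> B"
proof -
  obtain I0 where I0: "I0 \<in> ideals K" "B = narrow_equiv K `` {I0}"
    using B unfolding narrow_ideal_classes_def by (auto elim: quotientE)
  then obtain a where a: "a \<in> K" "totally_positive a" "I = (\<lambda>x. a * x) ` I0"
    using I unfolding narrow_equiv_def by auto
  have "(\<lambda>x. c * x) ` I \<in> ideals K" using class_ideal[OF B I] c by (intro ideal_scale) auto
  moreover have "(\<lambda>x. c * x) ` I = (\<lambda>x. (c * a) * x) ` I0" unfolding a(3) by (auto simp: image_image mult.assoc)
  moreover have "c * a \<in> K" "totally_positive (c * a)" using a c by (auto simp: K_mult conj_mult)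
  ultimately show ?thesis using I0 unfolding narrow_equiv_def by auto
qed

lemma class_related:
  assumes B: "B \<in> narrow_ideal_classes K" and I: "I \<in> B" and J: "J \<in> B"
  obtains c where "c \<in> K" "totally_positive c" "J = (\<lambda>x. c * x) ` I"
proof -
  obtain I0 where I0: "I0 \<in> ideals K" "B = narrow_equiv K `` {I0}"
    using B unfolding narrow_ideal_classes_def by (auto elim: quotientE)
  obtain a where a: "a \<in> K" "totally_positive a" "I = (\<lambda>x. a * x) ` I0"
    using I I0(2) unfolding narrow_equiv_def by auto
  obtain b where b: "b \<in> K" "totally_positive b" "J = (\<lambda>x. b * x) ` I0"
    using J I0(2) unfolding narrow_equiv_def by auto
  show ?thesis
  proof (rule that[of "b / a"])
    show "b / a \<in> K" using a b by (intro K_divide)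
    show "totally_positive (b / a)" using a b by (auto simp: conj_divide)
    show "J = (\<lambda>x. b / a * x) ` I" unfolding a(3) b(3) image_image using a(2) by (intro image_cong) auto
  qed
qed

end

section \<open>Existence and finiteness of reduced numbers\<close>

lemma discrete_minimum:
  fixes f :: "'a \<Rightarrow> real"
  assumes "x0 \<in> S" "\<And>x. x \<in> S \<Longrightarrow> f x > 0" "\<And>x. x \<in> S \<Longrightarrow> f x \<in> \<int>"
  obtains x where "x \<in> S" "\<And>y. y \<in> S \<Longrightarrow> f x \<le> f y"
proof -
  obtain x where x: "x \<in> S" "\<And>y. y \<in> S \<Longrightarrow> nat \<lfloor>f x\<rfloor> \<le> nat \<lfloor>f y\<rfloor>"
    using ex_has_least_nat[of "\<lambda>x. x \<in> S" x0 "\<lambda>x. nat \<lfloor>f x\<rfloor>"] assms(1) by blast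
  have e: "f y = real (nat \<lfloor>f y\<rfloor>)" if "y \<in> S" for y
    using assms(2,3)[OF that] by (auto elim!: Ints_cases)
  show ?thesis
  proof (rule that[OF x(1)])
    fix y assume "y \<in> S"
    then show "f x \<le> f y" using x(2) e[OF x(1)] e[of y] by (metis of_nat_mono)
  qed
qed

lemma is_Z_basisD: "is_Z_basis I x y \<Longrightarrow> z \<in> I \<Longrightarrow> \<exists>m n. z = of_int m * x + of_int n * y"
  unfolding is_Z_basis_def by blast

lemma is_Z_basis_mem: "is_Z_basis I x y \<Longrightarrow> of_int m * x + of_int n * y \<in> I"
  unfolding is_Z_basis_def by blast

lemma is_Z_basis_inj:
  assumes "is_Z_basis I x y" "of_int m * x + of_int n * y = of_int m' * x + of_int n' * y"
  shows "m = m'" "n = n'"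
proof -
  have "of_int (m - m') * x + of_int (n - n') * y = 0" using assms(2) by (simp add: algebra_simps)
  then have "m - m' = 0 \<and> n - n' = 0" using assms(1) unfolding is_Z_basis_def by blast
  then show "m = m'" "n = n'" by auto
qed

lemma is_Z_basis_commute:
  assumes "is_Z_basis I x y"
  shows "is_Z_basis I y x"
proof -
  have e: "of_int m * y + of_int n * x = of_int n * x + of_int m * y" for m n :: int
    by (rule add.commute)
  show ?thesis using assms unfolding is_Z_basis_def e by blast
qed

lemma is_Z_basis_scale:
  assumes "is_Z_basis I x y" "c \<noteq> 0"
  shows "is_Z_basis ((\<lambda>z. c * z) ` I) (c * x) (c * y)"
proof -
  have e: "of_int m * (c * x) + of_int n * (c * y) = c * (of_int m * x + of_int n * y)" for m n
    by (simp add: algebra_simps)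
  have "(\<lambda>z. c * z) ` I = {of_int m * (c * x) + of_int n * (c * y) | m n. True}"
    unfolding e using assms(1) unfolding is_Z_basis_def by auto
  moreover have "m = 0 \<and> n = 0" if "of_int m * (c * x) + of_int n * (c * y) = 0" for m n
    using that assms unfolding e is_Z_basis_def by auto
  ultimately show ?thesis unfolding is_Z_basis_def by blast
qed

text \<open>The unimodular base change behind one step of the minus continued fraction.\<close>

lemma is_Z_basis_swap_shift:
  assumes "is_Z_basis I x y"
  shows "is_Z_basis I (of_int b * x - y) x"
proof -
  have e: "of_int m * (of_int b * x - y) + of_int n * x = of_int (m * b + n) * x + of_int (- m) * y" for m n
    by (simp add: algebra_simps)
  have e2: "of_int m * x + of_int n * y = of_int (- n) * (of_int b * x - y) + of_int (m + n * b) * x" for m n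
    by (simp add: algebra_simps)
  have "I = {of_int m * (of_int b * x - y) + of_int n * x | m n. True}"
  proof (intro equalityI subsetI)
    fix z assume "z \<in> I"
    then obtain m n where "z = of_int m * x + of_int n * y" using is_Z_basisD[OF assms] by blast
    then show "z \<in> {of_int m * (of_int b * x - y) + of_int n * x | m n. True}" unfolding e2 by blast
  next
    fix z assume "z \<in> {of_int m * (of_int b * x - y) + of_int n * x | m n. True}"
    then show "z \<in> I" unfolding e using is_Z_basis_mem[OF assms] by blast
  qed
  moreover have "m = 0 \<and> n = 0" if "of_int m * (of_int b * x - y) + of_int n * x = 0" for m n
  proof -
    have "m * b + n = 0 \<and> - m = 0" using that assms unfolding e is_Z_basis_def by blast
    then show ?thesis by auto
  qed
  ultimately show ?thesis unfolding is_Z_basis_def by blast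
qed

context quadratic_generator
begin

text \<open>A lattice argument in the plane with coordinates $(x, x')$.  Let \<open>Y\<close> have least trace among the
  totally positive elements, and among the totally positive \<open>x\<close> with $x' < Y'$ let \<open>X\<close> have least
  determinant against \<open>Y\<close>.  Minimality of the trace gives \<open>Y < X\<close>, and a nonzero lattice point in
  the triangle with vertices \<open>0\<close>, \<open>X\<close>, \<open>Y\<close> would violate one of the two choices.  Since the
  fundamental parallelogram is the union of this triangle and its reflection, \<open>X\<close> and \<open>Y\<close> span the
  ideal.\<close>

lemma ideal_reduced_basis:
  assumes I: "I \<in> ideals K"
  obtains X Y where "is_Z_basis I X Y" "X \<in> I" "Y \<in> I" "totally_positive X" "totally_positive Y" "Y < X" "conj X < conj Y"
proof -
  obtain m where m: "m > 0" "\<And>x. x \<in> I \<Longrightarrow> of_int m * x \<in> ring_of_integers K"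
    by (rule ideal_denominator[OF I]) blast
  have IK: "x \<in> K" if "x \<in> I" for x using ideal_in_K[OF I that] .
  define P where "P = {x \<in> I. totally_positive x}"
  obtain x0 where x0: "x0 \<in> I" "x0 \<noteq> 0" using I unfolding ideals_def by blast
  have "(of_int m * x0) * x0 \<in> P"
    unfolding P_def using ideal_mult[OF I m(2)[OF x0(1)] x0(1)] x0(2) m(1) conj_eq_0[OF IK[OF x0(1)]] IK[OF x0(1)]
    by (auto simp: conj_mult K_mult K_rat conj_rat zero_less_mult_iff mult_less_0_iff linorder_neq_iff)
  moreover have "of_int m * (x + conj x) > 0" if "x \<in> P" for x
    using that m(1) by (auto simp: P_def)
  moreover have "of_int m * (x + conj x) \<in> \<int>" if "x \<in> P" for x
  proof -
    have x: "of_int m * x \<in> ring_of_integers K" "x \<in> K" using that m(2) IK by (auto simp: P_def)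
    from ring_of_integers_trace_norm(1)[OF x(1)] show ?thesis using x(2)
      by (simp add: conj_mult K_rat conj_rat distrib_left)
  qed
  ultimately obtain Y where Y: "Y \<in> P" "\<And>Z. Z \<in> P \<Longrightarrow> of_int m * (Y + conj Y) \<le> of_int m * (Z + conj Z)"
    using discrete_minimum[of _ P "\<lambda>x. of_int m * (x + conj x)"] by metis
  have Ymin: "Y + conj Y \<le> Z + conj Z" if "Z \<in> P" for Z
    using Y(2)[OF that] m(1) by simp
  have YI: "Y \<in> I" "Y > 0" "conj Y > 0" using Y(1) by (auto simp: P_def)
  define Q where "Q = {x \<in> P. conj x < conj Y}"
  define det where "det = (\<lambda>x. x * conj Y - conj x * Y)"
  have QY: "Y < x" if "x \<in> Q" for x using that Ymin[of x] by (auto simp: Q_def)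
  have det_pos: "det x > 0" if "x \<in> Q" for x
  proof -
    have "conj x * Y < conj Y * x"
      using that QY[OF that] YI by (intro mult_strict_mono) (auto simp: Q_def P_def)
    then show ?thesis by (simp add: det_def mult.commute)
  qed
  \<comment> \<open>Multiplication by the totally positive integer \<open>u\<close> shrinks conjugates, so \<open>u * Y\<close> lies in \<open>Q\<close>.\<close>
  define g where "g = \<lceil>\<theta>\<rceil>"
  define u where "u = of_int g + \<theta>"
  have u: "u \<in> ring_of_integers K" "u \<in> K" "conj u = of_int g - \<theta>"
    unfolding u_def using ring_of_integers_gen_order[OF gen_order_intro[of g 1]] galois_conj_repr[of "of_int g" 1]
    by (auto simp: ring_of_integers_def)
  have "of_int g > \<theta>" "of_int g < \<theta> + 1"
  proof -
    have "of_int g \<noteq> \<theta>" using theta_irrational by (metis Rats_of_int)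
    moreover have "of_int g \<ge> \<theta>" unfolding g_def by linarith
    ultimately show "of_int g > \<theta>" by simp
    show "of_int g < \<theta> + 1" unfolding g_def by linarith
  qed
  then have u': "u > 0" "conj u > 0" "conj u < 1" using theta_pos unfolding u(3) unfolding u_def by auto
  have "u * Y \<in> Q"
    using u' YI ideal_mult[OF I u(1) YI(1)] by (simp add: Q_def P_def conj_mult u IK)
  moreover have "of_int m * of_int m * \<theta> * det x > 0" if "x \<in> Q" for x
    using det_pos[OF that] m(1) theta_pos by simp
  moreover have "of_int m * of_int m * \<theta> * det x \<in> \<int>" if "x \<in> Q" for x
  proof -
    have xI: "x \<in> I" using that by (auto simp: Q_def P_def)
    \<comment> \<open>Conjugation negates both \<open>\<theta>\<close> and the determinant, so their product is a trace.\<close>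
    have "\<theta> * ((of_int m * x) * conj (of_int m * Y)) \<in> ring_of_integers K"
      by (intro ring_of_integers_mult ring_of_integers_theta ring_of_integers_conj m xI YI)
    from ring_of_integers_trace_norm(1)[OF this] show ?thesis
      using IK[OF xI] IK[OF YI(1)]
      by (simp add: conj_mult K_rat conj_rat K_mult conj_in_K conj_conj K_theta conj_theta det_def algebra_simps)
  qed
  ultimately obtain X where X: "X \<in> Q" "\<And>Z. Z \<in> Q \<Longrightarrow> of_int m * of_int m * \<theta> * det X \<le> of_int m * of_int m * \<theta> * det Z"
    using discrete_minimum[of _ Q "\<lambda>x. of_int m * of_int m * \<theta> * det x"] by metis
  have Xmin: "det X \<le> det Z" if "Z \<in> Q" for Z
    using X(2)[OF that] m(1) theta_pos by simp
  have XI: "X \<in> I" "X > 0" "conj X > 0" "Y < X" "conj X < conj Y"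
    using X(1) QY[OF X(1)] by (auto simp: Q_def P_def)
  note XK = IK[OF XI(1)] and YK = IK[OF YI(1)]
  define \<Delta> where "\<Delta> = det X"
  have \<Delta>: "\<Delta> > 0" using det_pos[OF X(1)] by (simp add: \<Delta>_def)
  have conj_comb: "conj (of_int k * X + of_int l * Y) = of_int k * conj X + of_int l * conj Y" for k l
    using XK YK by (simp add: conj_add conj_mult K_mult K_rat conj_rat)
  \<comment> \<open>If $a = 0$, the trace of \<open>Z\<close> is too small; otherwise \<open>Z\<close> competes with \<open>X\<close> and has the
    smaller determinant $a \Delta$.\<close>
  have triangle: "Z = 0" if Z: "Z \<in> I" "Z = a * X + b * Y" "conj Z = a * conj X + b * conj Y"
    and ab: "0 \<le> a" "a < 1" "0 \<le> b" "b < 1" "a + b \<le> 1" for Z a b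
  proof (rule ccontr)
    assume "Z \<noteq> 0"
    then have pos: "a > 0 \<or> b > 0" using Z(2) ab by auto
    have ZP: "Z \<in> P"
      unfolding P_def using Z pos ab XI YI by (auto intro: add_pos_nonneg add_nonneg_pos)
    have "a > 0"
    proof (rule ccontr)
      assume "\<not> a > 0"
      then have "Z + conj Z = b * (Y + conj Y)" using Z ab by (simp add: distrib_left)
      also have "\<dots> < 1 * (Y + conj Y)" using ab YI by (intro mult_strict_right_mono) auto
      finally show False using Ymin[OF ZP] by simp
    qed
    then have "a * conj X < a * conj Y" using XI by simp
    then have "conj Z < (a + b) * conj Y" using Z(3) by (simp add: distrib_right)
    also have "\<dots> \<le> conj Y" using ab YI by (simp add: mult_left_le_one_le)
    finally have "Z \<in> Q" using ZP by (simp add: Q_def)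
    moreover have "det Z = a * det X" unfolding det_def Z(3) unfolding Z(2) by (simp add: algebra_simps)
    ultimately show False using Xmin[of Z] ab \<Delta> by (simp add: \<Delta>_def)
  qed
  have span: "\<exists>k l. z = of_int k * X + of_int l * Y" if z: "z \<in> I" for z
  proof -
    define a where "a = (z * conj Y - conj z * Y) / \<Delta>"
    define b where "b = (X * conj z - conj X * z) / \<Delta>"
    have D: "\<Delta> = X * conj Y - conj X * Y" by (simp add: \<Delta>_def det_def)
    have za: "z = a * X + b * Y"
    proof -
      have "\<Delta> * z = (z * conj Y - conj z * Y) * X + (X * conj z - conj X * z) * Y"
        unfolding D by (simp add: algebra_simps)
      then have "z = ((z * conj Y - conj z * Y) * X + (X * conj z - conj X * z) * Y) / \<Delta>"
        using \<Delta> by (simp add: nonzero_eq_divide_eq mult.commute)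
      then show ?thesis by (simp add: a_def b_def add_divide_distrib)
    qed
    have zb: "conj z = a * conj X + b * conj Y"
    proof -
      have "\<Delta> * conj z = (z * conj Y - conj z * Y) * conj X + (X * conj z - conj X * z) * conj Y"
        unfolding D by (simp add: algebra_simps)
      then have "conj z = ((z * conj Y - conj z * Y) * conj X + (X * conj z - conj X * z) * conj Y) / \<Delta>"
        using \<Delta> by (simp add: nonzero_eq_divide_eq mult.commute)
      then show ?thesis by (simp add: a_def b_def add_divide_distrib)
    qed
    define W where "W = z - (of_int \<lfloor>a\<rfloor> * X + of_int \<lfloor>b\<rfloor> * Y)"
    have WI: "W \<in> I" unfolding W_def by (intro ideal_diff[OF I z] ideal_int_combination I XI YI)
    have W: "W = frac a * X + frac b * Y"
      unfolding W_def frac_def using za by (simp add: algebra_simps)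
    have W': "conj W = frac a * conj X + frac b * conj Y"
      unfolding W_def frac_def using zb conj_comb[of "\<lfloor>a\<rfloor>" "\<lfloor>b\<rfloor>"] IK[OF z] IK[OF ideal_int_combination[OF I XI(1) YI(1)]]
      by (simp add: conj_diff algebra_simps)
    have "W = 0"
    proof (cases "frac a + frac b \<le> 1")
      case True
      show ?thesis by (rule triangle[OF WI W W']) (use True frac_ge_0 frac_lt_1 in auto)
    next
      case False
      \<comment> \<open>Reflection in the centre of the parallelogram moves \<open>W\<close> into the triangle.\<close>
      define V where "V = (X + Y) - W"
      have VI: "V \<in> I" unfolding V_def using ideal_int_combination[OF I XI(1) YI(1), of 1 1] by (intro ideal_diff[OF I _ WI]) simp
      have V: "V = (1 - frac a) * X + (1 - frac b) * Y" unfolding V_def W by (simp add: algebra_simps)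
      have V': "conj V = (1 - frac a) * conj X + (1 - frac b) * conj Y"
        unfolding V_def using W' conj_comb[of 1 1] IK[OF WI] K_add[OF XK YK] by (simp add: conj_diff algebra_simps)
      have f: "frac a < 1" "frac b < 1" by (rule frac_lt_1)+
      have "V = 0" using triangle[OF VI V V'] False f by linarith
      moreover have "V > 0" unfolding V using f XI YI by (intro add_pos_pos mult_pos_pos) auto
      ultimately show ?thesis by simp
    qed
    then show ?thesis unfolding W_def by auto
  qed
  have indep: "k = 0 \<and> l = 0" if "of_int k * X + of_int l * Y = 0" for k l
  proof -
    have "of_int k * conj X + of_int l * conj Y = 0" using that conj_comb[of k l] conj_rat[of 0] by simp
    then have "of_int k * \<Delta> = 0" "of_int l * \<Delta> = 0"
      using that unfolding \<Delta>_def det_def by algebra+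
    then show ?thesis using \<Delta> by auto
  qed
  have "is_Z_basis I X Y"
    unfolding is_Z_basis_def
  proof (intro conjI allI impI)
    show "I = {of_int k * X + of_int l * Y | k l. True}"
      using span ideal_int_combination[OF I XI(1) YI(1)] by auto
  qed (use indep in auto)
  then show ?thesis using that XI YI by blast
qed

text \<open>Dividing a reduced basis \<open>X\<close>, \<open>Y\<close> of an ideal by the totally positive \<open>Y\<close> stays in the narrow
  class.\<close>

lemma Red_nonempty:
  assumes B: "B \<in> narrow_ideal_classes K"
  shows "Red K B \<noteq> {}"
proof -
  obtain I where I: "I \<in> B" "I \<in> ideals K" by (rule class_nonempty[OF B])
  obtain X Y where XY: "is_Z_basis I X Y" "X \<in> I" "Y \<in> I" "totally_positive X" "totally_positive Y" "Y < X" "conj X < conj Y"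
    by (rule ideal_reduced_basis[OF I(2)])
  have K: "X \<in> K" "Y \<in> K" using XY I ideal_in_K by blast+
  define c where "c = inverse Y"
  have c: "c \<in> K" "totally_positive c" using XY K by (auto simp: c_def K_inverse conj_inverse)
  have "is_Z_basis ((\<lambda>z. c * z) ` I) (c * Y) (c * X)"
  proof (rule is_Z_basis_scale)
    show "is_Z_basis I Y X" by (rule is_Z_basis_commute[OF XY(1)])
  qed (use c in auto)
  then have "is_Z_basis ((\<lambda>z. c * z) ` I) 1 (X / Y)" using XY by (simp add: c_def field_simps)
  moreover have "reduced K (X / Y)"
    unfolding reduced_def using XY K by (auto simp: K_divide conj_divide)
  ultimately show ?thesis unfolding Red_def using class_scale[OF B I(1) c] by blast
qed

text \<open>Multiplication by \<open>\<theta>\<close> maps the ideal with basis \<open>1\<close>, \<open>w\<close> to itself, so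
  $\theta = s + t w$ with integers \<open>s\<close>, \<open>t\<close>, and \<open>w\<close> is determined by them.  Reducedness says
  $t > 0$ and $|s + t| < \theta$; moreover \<open>t\<close> divides the positive number $d - (s+t)^2$, because
  $\theta w$ also lies in the ideal.  Both integers are thus bounded in terms of \<open>d\<close>.\<close>

lemma finite_Red:
  assumes B: "B \<in> narrow_ideal_classes K"
  shows "finite (Red K B)"
proof (rule finite_subset)
  show "Red K B \<subseteq> (\<lambda>(s, t). (\<theta> - of_int s) / of_int t) ` ({- (2 * d)..2 * d} \<times> {1..d})"
  proof
    fix w assume "w \<in> Red K B"
    then obtain I where w: "reduced K w" and I: "I \<in> B" "is_Z_basis I 1 w" by (auto simp: Red_def)
    from w have wK: "w \<in> K" "w > 1" "conj w < 1" "conj w > 0" by (auto simp: reduced_def)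
    have iI: "I \<in> ideals K" using class_ideal[OF B I(1)] .
    have "1 \<in> I" "w \<in> I" using is_Z_basis_mem[OF I(2), of 1 0] is_Z_basis_mem[OF I(2), of 0 1] by auto
    then have "\<theta> * 1 \<in> I" "\<theta> * w \<in> I" using ideal_mult[OF iI ring_of_integers_theta] by blast+
    then obtain s t p q where st: "\<theta> = of_int s + of_int t * w" and pq: "\<theta> * w = of_int p + of_int q * w"
      using is_Z_basisD[OF I(2)] by (metis mult.right_neutral)
    have "conj \<theta> = of_int s + of_int t * conj w"
      using arg_cong[OF st, of conj] wK by (simp add: conj_add conj_mult K_mult K_rat conj_rat)
    then have st': "- \<theta> = of_int s + of_int t * conj w" by (simp add: conj_theta)
    have "2 * \<theta> = of_int t * (w - conj w)" using st st' by (simp add: algebra_simps)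
    then have "of_int t * (w - conj w) > 0" using theta_pos by simp
    then have t: "t > 0" using wK by (simp add: zero_less_mult_iff)
    have w_eq: "w = (\<theta> - of_int s) / of_int t" using st t by (simp add: field_simps)
    have "of_int d - of_int s * \<theta> = of_int p * of_int t + of_int q * (\<theta> - of_int s)"
    proof -
      have tw: "of_int t * w = \<theta> - of_int s" using st by simp
      have "of_int d - of_int s * \<theta> = \<theta> * (of_int t * w)"
        unfolding tw right_diff_distrib theta_sq by simp
      also have "\<dots> = of_int t * (of_int p + of_int q * w)" unfolding pq[symmetric] by simp
      also have "\<dots> = of_int p * of_int t + of_int q * (of_int t * w)" by (simp add: algebra_simps)
      finally show ?thesis unfolding tw .
    qed
    then have "of_int d + of_int (- s) * \<theta> = of_int (p * t - q * s) + of_int q * \<theta>" by (simp add: algebra_simps)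
    then have "of_int d = (of_int (p * t - q * s) :: real)" "of_int (- s) = (of_int q :: real)"
      using repr_unique[of "of_int d" "of_int (- s)" "of_int (p * t - q * s)" "of_int q"] by auto
    then have d_eq: "d = p * t - q * s" "q = - s" by linarith+
    have lt: "\<bar>of_int (s + t)\<bar> < \<theta>"
    proof -
      have "of_int t * conj w < of_int t" using wK t by simp
      then have 1: "- \<theta> < of_int (s + t)" using st' by simp
      have "of_int t < of_int t * w" using wK t by simp
      then have "of_int (s + t) < \<theta>" using st by simp
      with 1 show ?thesis by (simp add: abs_less_iff)
    qed
    then have "of_int (s + t) * of_int (s + t) < \<theta> * \<theta>"
      using abs_mult_less[OF lt lt] by simp
    then have sq: "(s + t) * (s + t) < d" unfolding theta_sq by (metis of_int_less_iff of_int_mult)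
    have "d - (s + t) * (s + t) = t * (p - 2 * s - t)" using d_eq by (simp add: algebra_simps)
    then have "t dvd d - (s + t) * (s + t)" by simp
    then have "t \<le> d - (s + t) * (s + t)" using sq by (intro zdvd_imp_le) auto
    then have td: "t \<le> d" by (smt (verit) zero_le_square)
    have "\<bar>s + t\<bar> \<le> (s + t) * (s + t)"
      using mult_right_mono[of 1 "\<bar>s + t\<bar>" "\<bar>s + t\<bar>"] by (cases "s + t = 0") auto
    then have "\<bar>s + t\<bar> \<le> d" using sq by linarith
    then have "s \<in> {- (2 * d)..2 * d}" "t \<in> {1..d}" using t td by auto
    then show "w \<in> (\<lambda>(s, t). (\<theta> - of_int s) / of_int t) ` ({- (2 * d)..2 * d} \<times> {1..d})"
      using w_eq by (intro image_eqI[of _ _ "(s, t)"]) auto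
  qed
qed simp

end

section \<open>The cycle of reduced numbers\<close>

text \<open>By the pigeonhole principle and injectivity, the orbit of a point is purely periodic;
  \<open>r\<close> is its least period.\<close>

lemma finite_injective_orbit:
  assumes fin: "finite R" and maps: "f ` R \<subseteq> R" and inj: "inj_on f R" and w: "w \<in> R"
  obtains r where "r > 0" "inj_on (\<lambda>i. (f ^^ i) w) {..<r}" "\<And>i. (f ^^ i) w = (f ^^ (i mod r)) w"
proof -
  have mem: "(f ^^ i) w \<in> R" for i by (induction i) (use w maps in auto)
  have cancel: "(f ^^ j) w = w" if "(f ^^ (i + j)) w = (f ^^ i) w" for i j
    using that
  proof (induction i)
    case (Suc i)
    then have "f ((f ^^ (i + j)) w) = f ((f ^^ i) w)" by simp
    then show ?case using inj_onD[OF inj] mem Suc.IH by blast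
  qed simp
  define P where "P = (\<lambda>r. r > 0 \<and> (f ^^ r) w = w)"
  have "\<not> inj (\<lambda>i. (f ^^ i) w)"
  proof
    assume "inj (\<lambda>i. (f ^^ i) w)"
    moreover have "finite (range (\<lambda>i. (f ^^ i) w))" by (rule finite_subset[OF _ fin]) (use mem in auto)
    ultimately show False using finite_imageD by blast
  qed
  then obtain i j where "(f ^^ i) w = (f ^^ j) w" "i < j" unfolding inj_def by (metis linorder_neqE_nat)
  then have "P (j - i)" using cancel[of i "j - i"] by (simp add: P_def)
  define r where "r = (LEAST r. P r)"
  have r: "r > 0" "(f ^^ r) w = w" using LeastI[of P, OF \<open>P (j - i)\<close>] by (auto simp: r_def P_def)
  have least: "\<not> P k" if "k < r" for k using that not_less_Least by (auto simp: r_def)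
  show ?thesis
  proof (rule that[OF r(1)])
    show "inj_on (\<lambda>i. (f ^^ i) w) {..<r}"
    proof (rule linorder_inj_onI)
      fix a b assume ab: "a < b" "a \<in> {..<r}" "b \<in> {..<r}"
      then show "(f ^^ a) w \<noteq> (f ^^ b) w"
        using cancel[of a "b - a"] least[of "b - a"] by (auto simp: P_def)
    qed auto
    have mult: "(f ^^ (r * k)) w = w" for k
      by (induction k) (use r in \<open>auto simp: funpow_add\<close>)
    show "(f ^^ i) w = (f ^^ (i mod r)) w" for i
    proof -
      have "(f ^^ (i mod r + r * (i div r))) w = (f ^^ (i mod r)) w" unfolding funpow_add o_def mult ..
      then show ?thesis by simp
    qed
  qed
qed

text \<open>One level of the continued fraction replaces the error \<open>c - y\<close> of a tail by
  $1/y - 1/c = (c - y)/(yc)$.  The errors are nonnegative, so $c \ge y \ge \mu$, and each level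
  contracts by at least the factor $1/\mu$.\<close>

lemma minus_cf_eq:
  fixes x :: "nat \<Rightarrow> real"
  assumes \<mu>: "\<mu> > 1" and lb: "\<And>i. x i \<ge> \<mu>" and step: "\<And>i. x (Suc i) = 1 / (of_int (a i) - x i)"
  shows "minus_cf a = x 0"
proof -
  have eq: "x i = of_int (a i) - 1 / x (Suc i)" for i unfolding step by simp
  have xpos: "x i > 0" for i using lb[of i] \<mu> by linarith
  have bound: "0 \<le> minus_cf_conv (\<lambda>i. a (m + i)) n - x m \<and> minus_cf_conv (\<lambda>i. a (m + i)) n - x m \<le> (1 / \<mu>) ^ n" for m n
  proof (induction n arbitrary: m)
    case 0
    have "minus_cf_conv (\<lambda>i. a (m + i)) 0 - x m = 1 / x (Suc m)" using eq[of m] by simp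
    moreover have "1 / x (Suc m) \<le> 1" using lb[of "Suc m"] \<mu> by simp
    ultimately show ?case using xpos[of "Suc m"] by simp
  next
    case (Suc n)
    define c where "c = minus_cf_conv (\<lambda>i. a (Suc m + i)) n"
    define y where "y = x (Suc m)"
    have c: "0 \<le> c - y" "c - y \<le> (1 / \<mu>) ^ n" using Suc[of "Suc m"] by (auto simp: c_def y_def)
    have y: "y \<ge> \<mu>" "y > 0" using lb xpos by (auto simp: y_def)
    have e: "minus_cf_conv (\<lambda>i. a (m + i)) (Suc n) - x m = (c - y) / (y * c)"
    proof -
      have "minus_cf_conv (\<lambda>i. a (m + i)) (Suc n) = of_int (a m) - 1 / c" by (simp add: c_def)
      then have "minus_cf_conv (\<lambda>i. a (m + i)) (Suc n) - x m = 1 / y - 1 / c" using eq[of m] by (simp add: y_def)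
      also have "\<dots> = (c - y) / (y * c)" using y c by (simp add: diff_frac_eq)
      finally show ?thesis .
    qed
    have "(c - y) / (y * c) \<le> (1 / \<mu>) ^ n / \<mu>"
    proof (rule frac_le)
      have "\<mu> * 1 \<le> y * c" using y c \<mu> by (intro mult_mono) auto
      then show "\<mu> \<le> y * c" by simp
    qed (use c \<mu> in auto)
    moreover have "(c - y) / (y * c) \<ge> 0" using c y by simp
    ultimately show ?case unfolding e by (simp add: mult.commute)
  qed
  have "(\<lambda>n. minus_cf_conv a n - x 0) \<longlonglongrightarrow> 0"
  proof (rule tendsto_sandwich[OF _ _ tendsto_const LIMSEQ_power_zero[of "1 / \<mu>"]])
    show "norm (1 / \<mu>) < 1" using \<mu> by simp
  qed (use bound[of 0] in \<open>auto intro!: always_eventually\<close>)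
  then have "minus_cf_conv a \<longlonglongrightarrow> x 0" by (simp add: LIM_zero_iff)
  then show ?thesis unfolding minus_cf_def by (rule limI)
qed

definition minus_cf_step :: "real \<Rightarrow> real" where
  "minus_cf_step w = 1 / (of_int \<lceil>w\<rceil> - w)"

context quadratic_generator
begin

lemma reduced_minus_cf_step:
  assumes w: "reduced K w"
  defines "u \<equiv> of_int \<lceil>w\<rceil> - w"
  shows "\<lceil>w\<rceil> \<ge> 2" "u \<in> K" "0 < u" "u < 1" "conj u = of_int \<lceil>w\<rceil> - conj w" "conj u > 1" "reduced K (minus_cf_step w)"
proof -
  have wK: "w \<in> K" "w > 1" "conj w < 1" "conj w > 0" using w by (auto simp: reduced_def)
  show b: "\<lceil>w\<rceil> \<ge> 2" using wK(2) by linarith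
  show uK: "u \<in> K" unfolding u_def by (rule K_diff[OF K_rat[OF Rats_of_int] wK(1)])
  have "conj w \<noteq> w" using wK by linarith
  then have "w \<notin> \<rat>" using conj_eq_iff[OF wK(1)] by blast
  then have "of_int \<lceil>w\<rceil> \<noteq> w" by (metis Rats_of_int)
  moreover have "of_int \<lceil>w\<rceil> \<ge> w" by linarith
  ultimately show "0 < u" unfolding u_def by linarith
  moreover show "u < 1" unfolding u_def by linarith
  ultimately have u: "0 < u" "u < 1" .
  show cu: "conj u = of_int \<lceil>w\<rceil> - conj w" unfolding u_def using wK by (simp add: conj_diff K_rat conj_rat)
  have "(2::real) \<le> of_int \<lceil>w\<rceil>" using b by linarith
  then show cu1: "conj u > 1" unfolding cu using wK by linarith
  have "minus_cf_step w = inverse u" by (simp add: minus_cf_step_def u_def inverse_eq_divide)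
  then show "reduced K (minus_cf_step w)"
    unfolding reduced_def using uK u cu1 by (auto simp: K_inverse conj_inverse one_less_inverse inverse_less_1_iff)
qed

text \<open>The new basis arises from the old one by a unimodular change followed by division by the totally
  positive number $\lceil w \rceil - w$.\<close>

lemma minus_cf_step_Red:
  assumes B: "B \<in> narrow_ideal_classes K" and w: "w \<in> Red K B"
  shows "minus_cf_step w \<in> Red K B"
proof -
  obtain I where r: "reduced K w" and I: "I \<in> B" "is_Z_basis I 1 w" using w by (auto simp: Red_def)
  define u where "u = of_int \<lceil>w\<rceil> - w"
  note u = reduced_minus_cf_step[OF r, folded u_def]
  have "is_Z_basis I u 1" using is_Z_basis_swap_shift[OF I(2), of "\<lceil>w\<rceil>"] by (simp add: u_def)
  then have "is_Z_basis ((\<lambda>z. inverse u * z) ` I) (inverse u * u) (inverse u * 1)"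
    by (rule is_Z_basis_scale) (use u in auto)
  then have "is_Z_basis ((\<lambda>z. inverse u * z) ` I) 1 (minus_cf_step w)"
    using u by (simp add: minus_cf_step_def u_def[symmetric] inverse_eq_divide)
  moreover have "(\<lambda>z. inverse u * z) ` I \<in> B"
    using u by (intro class_scale[OF B I(1)]) (auto simp: K_inverse conj_inverse)
  ultimately show ?thesis using u unfolding Red_def by blast
qed

text \<open>Equal images force \<open>w - v\<close> to be a rational integer; it equals its conjugate, a difference of
  two numbers in the unit interval, and so vanishes.\<close>

lemma minus_cf_step_inj:
  assumes w: "reduced K w" and v: "reduced K v" and eq: "minus_cf_step w = minus_cf_step v"
  shows "w = v"
proof -
  have "of_int \<lceil>w\<rceil> - w = of_int \<lceil>v\<rceil> - v" using eq by (simp add: minus_cf_step_def)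
  then have d: "w - v = of_int (\<lceil>w\<rceil> - \<lceil>v\<rceil>)" by simp
  have wv: "w \<in> K" "v \<in> K" "conj w < 1" "conj w > 0" "conj v < 1" "conj v > 0" using w v by (auto simp: reduced_def)
  have "conj w - conj v = of_int (\<lceil>w\<rceil> - \<lceil>v\<rceil>)"
    unfolding conj_diff[OF wv(1,2), symmetric] d by (rule conj_rat) simp
  then have "\<bar>of_int (\<lceil>w\<rceil> - \<lceil>v\<rceil>)\<bar> < (1::real)" using wv by linarith
  then have "\<lceil>w\<rceil> - \<lceil>v\<rceil> = 0" by linarith
  then show ?thesis using d by simp
qed

text \<open>Two reduced bases \<open>vC\<close>, \<open>C\<close> and \<open>w\<close>, \<open>1\<close> of one lattice are related by an integer matrix of
  determinant \<open>1\<close>.  If \<open>vC\<close> lies outside the cone spanned by \<open>w\<close> and \<open>1\<close> on the side of \<open>1\<close>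
  ($p \le 0$), one continued fraction step for \<open>w\<close> replaces the entry \<open>q\<close> by the smaller \<open>-p\<close>.
  If it lies in the cone ($p > 0$), then the two rows of the matrix are incomparable, because
  \<open>v\<close> is reduced; with \<open>C\<close> positive and determinant \<open>1\<close> this leaves only the identity matrix.\<close>

lemma reduced_chain:
  assumes "reduced K w" "reduced K v" "C \<in> K" "totally_positive C"
    and "v * C = of_int p * w + of_int q" "C = of_int r * w + of_int s" "p * s - q * r = 1" "q \<ge> 0"
  shows "\<exists>i. v = (minus_cf_step ^^ i) w"
  using assms
proof (induction "nat q" arbitrary: w p q r s C rule: less_induct)
  case less
  note w = less.prems(1) and v = less.prems(2) and C = less.prems(3,4)
    and vC = less.prems(5) and Cw = less.prems(6) and det = less.prems(7) and q = less.prems(8)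
  have wK: "w \<in> K" "w > 1" "conj w < 1" "conj w > 0" using w by (auto simp: reduced_def)
  have vK: "v \<in> K" "v > 1" "conj v < 1" "conj v > 0" using v by (auto simp: reduced_def)
  have gt: "v * C > C" using vK C by simp
  have lt: "conj v * conj C < conj C" using vK C by simp
  have cvC: "conj v * conj C = of_int p * conj w + of_int q"
    using arg_cong[OF vC, of conj] wK vK C by (simp add: conj_add conj_mult K_mult K_rat conj_rat)
  have cC: "conj C = of_int r * conj w + of_int s"
    using arg_cong[OF Cw, of conj] wK C by (simp add: conj_add conj_mult K_mult K_rat conj_rat)
  show ?case
  proof (cases "p \<le> 0")
    case True
    define b where "b = \<lceil>w\<rceil>"
    define u where "u = of_int b - w"
    note u = reduced_minus_cf_step[OF w, folded b_def, folded u_def]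
    have wu: "w = of_int b - u" by (simp add: u_def)
    have Tw: "minus_cf_step w = 1 / u" by (simp add: minus_cf_step_def u_def b_def)
    have "q > 0"
    proof (rule ccontr)
      assume "\<not> q > 0"
      then have "v * C \<le> 0" using vC True wK q by (simp add: mult_nonpos_nonneg)
      then show False using gt C by simp
    qed
    have "- p < q"
    proof (cases "p = 0")
      case False
      then have "of_int p * w < of_int p" using True wK by (simp add: mult_less_cancel_left1)
      moreover have "of_int p * w + of_int q > 0" using gt C vC by simp
      ultimately have "of_int (- p) < (of_int q :: real)" by simp
      then show ?thesis by linarith
    qed (use \<open>q > 0\<close> in simp)
    have "\<exists>i. v = (minus_cf_step ^^ i) (minus_cf_step w)"
    proof (rule less.hyps[of "- p" "minus_cf_step w" "C / u" "p * b + q" "r * b + s" "- r"])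
      show "nat (- p) < nat q" using \<open>- p < q\<close> True \<open>q > 0\<close> by simp
      show "v * (C / u) = of_int (p * b + q) * minus_cf_step w + of_int (- p)"
        using vC u(3) unfolding Tw unfolding wu by (simp add: field_simps)
      show "C / u = of_int (r * b + s) * minus_cf_step w + of_int (- r)"
        using Cw u(3) unfolding Tw unfolding wu by (simp add: field_simps)
      show "(p * b + q) * (- r) - (- p) * (r * b + s) = 1" using det by (simp add: algebra_simps)
      show "reduced K (minus_cf_step w)" by (rule u)
      show "C / u \<in> K" "totally_positive (C / u)" using C u by (auto simp: K_divide conj_divide)
    qed (use v True in auto)
    then obtain i where "v = (minus_cf_step ^^ i) (minus_cf_step w)" by blast
    then have "v = (minus_cf_step ^^ Suc i) w" by (simp only: funpow_Suc_right o_apply)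
    then show ?thesis by blast
  next
    case False
    then have p: "p \<ge> 1" by simp
    \<comment> \<open>If one row dominated the other, $vC - C$ or its negative would be totally nonnegative,
      against $v > 1 > v'$.\<close>
    have dom1: False if "p \<le> r" "q \<le> s"
    proof -
      have "of_int p * w + of_int q \<le> of_int r * w + of_int s"
        using that wK by (intro add_mono mult_right_mono) auto
      then show False using gt vC Cw by simp
    qed
    have dom2: False if "r \<le> p" "s \<le> q"
    proof -
      have "of_int r * conj w + of_int s \<le> of_int p * conj w + of_int q"
        using that wK by (intro add_mono mult_right_mono) auto
      then show False using lt cvC cC by simp
    qed
    have "r = 0"
    proof (rule ccontr)
      assume "r \<noteq> 0"
      then consider "r < 0" | "r > 0" by linarith
      then show False
      proof cases
        case 1
        have "s \<ge> 1"
        proof (rule ccontr)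
          assume "\<not> s \<ge> 1"
          then have "of_int r * w + of_int s < 0" using 1 wK
            by (intro add_neg_nonpos mult_neg_pos) auto
          then show False using Cw C by simp
        qed
        have "p * s - q * r \<ge> 1 * 1 - q * r" using p \<open>s \<ge> 1\<close> by (intro diff_right_mono mult_mono) auto
        then have "q * (- r) \<le> 0" using det by simp
        then have q0: "q = 0" using q 1 by (simp add: zero_le_mult_iff mult_le_0_iff)
        then have "s = 1" using det p \<open>s \<ge> 1\<close> by (simp add: zmult_eq_1_iff)
        have "of_int r * w \<le> (-1) * w" using 1 wK by (intro mult_right_mono) auto
        then have "C < 0" using Cw \<open>s = 1\<close> wK by simp
        then show False using C by simp
      next
        case 2
        have "p * s = 1 + q * r" using det by simp
        also have "\<dots> \<ge> 1" using q 2 by simp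
        finally have "p * s > 0" by simp
        then have s: "s \<ge> 1" using p by (simp add: zero_less_mult_iff)
        show False
        proof (cases "p \<le> r")
          case True
          have "q \<le> s"
          proof (rule ccontr)
            assume "\<not> q \<le> s"
            then have "s * p \<le> q * r" using True p s by (intro mult_mono) auto
            then show False using det by (simp add: mult.commute)
          qed
          then show False using dom1 True by blast
        next
          case False
          have "s \<le> q"
          proof (rule ccontr)
            assume "\<not> s \<le> q"
            then have "q \<le> s - 1" by simp
            then have "q * r \<le> (s - 1) * r" using 2 by (intro mult_right_mono) auto
            moreover have "(r + 1) * s \<le> p * s" using False s by (intro mult_right_mono) auto
            ultimately have "(r + 1) * s - (s - 1) * r \<le> 1" using det by linarith
            then have "s + r \<le> 1" by (simp add: algebra_simps)
            then show False using s 2 by linarith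
          qed
          then show False using dom2 False by simp
        qed
      qed
    qed
    then have "p * s = 1" using det by simp
    then have ps: "p = 1" "s = 1" using p by (auto simp: zmult_eq_1_iff)
    have "q = 0"
    proof (rule ccontr)
      assume "q \<noteq> 0"
      then show False using dom2 ps q \<open>r = 0\<close> by simp
    qed
    then have "v = w" using vC Cw ps \<open>r = 0\<close> by simp
    then show ?thesis by (intro exI[of _ 0]) simp
  qed
qed

text \<open>Two reduced numbers of the class give two bases of the same ideal.  The transition matrix has
  determinant $\pm 1$, and positive determinant since both bases have the same orientation.  If
  its upper right entry is negative, the inverse matrix has a positive one, and the roles of
  \<open>w\<close> and \<open>v\<close> are exchanged.\<close>

lemma Red_connected:
  assumes B: "B \<in> narrow_ideal_classes K" and w: "w \<in> Red K B" and v: "v \<in> Red K B"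
  shows "(\<exists>i. v = (minus_cf_step ^^ i) w) \<or> (\<exists>i. w = (minus_cf_step ^^ i) v)"
proof -
  obtain I where rw: "reduced K w" and I: "I \<in> B" "is_Z_basis I 1 w" using w by (auto simp: Red_def)
  obtain J where rv: "reduced K v" and J: "J \<in> B" "is_Z_basis J 1 v" using v by (auto simp: Red_def)
  have wK: "w \<in> K" "w > 1" "conj w < 1" "conj w > 0" using rw by (auto simp: reduced_def)
  have vK: "v \<in> K" "v > 1" "conj v < 1" "conj v > 0" using rv by (auto simp: reduced_def)
  obtain C where C: "C \<in> K" "totally_positive C" and IJ: "I = (\<lambda>x. C * x) ` J" by (rule class_related[OF B J(1) I(1)])
  have bas: "is_Z_basis I C (C * v)" using is_Z_basis_scale[OF J(2), of C] C IJ by simp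
  have mem: "C \<in> I" "C * v \<in> I" "1 \<in> I" "w \<in> I"
    using is_Z_basis_mem[OF bas, of 1 0] is_Z_basis_mem[OF bas, of 0 1]
      is_Z_basis_mem[OF I(2), of 1 0] is_Z_basis_mem[OF I(2), of 0 1] by auto
  obtain s r where C_eq: "C = of_int r * w + of_int s" using is_Z_basisD[OF I(2) mem(1)] by (auto simp: add.commute)
  obtain q p where Cv_eq: "v * C = of_int p * w + of_int q" using is_Z_basisD[OF I(2) mem(2)] by (auto simp: add.commute mult.commute)
  obtain s' r' where one_eq: "1 = of_int r' * (v * C) + of_int s' * C" using is_Z_basisD[OF bas mem(3)] by (auto simp: add.commute mult.commute)
  obtain q' p' where w_eq: "w = of_int p' * (v * C) + of_int q' * C" using is_Z_basisD[OF bas mem(4)] by (auto simp: add.commute mult.commute)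
  have e1: "of_int 1 * 1 + of_int 0 * w = of_int (r' * q + s' * s) * 1 + of_int (r' * p + s' * r) * w"
    using one_eq[unfolded Cv_eq, unfolded C_eq] by (simp add: algebra_simps)
  have e2: "of_int 0 * 1 + of_int 1 * w = of_int (p' * q + q' * s) * 1 + of_int (p' * p + q' * r) * w"
    using w_eq[unfolded Cv_eq, unfolded C_eq] by (simp add: algebra_simps)
  note m1 = is_Z_basis_inj[OF I(2) e1] and m2 = is_Z_basis_inj[OF I(2) e2]
  have "(p' * s' - q' * r') * (p * s - q * r) = (p' * p + q' * r) * (r' * q + s' * s) - (p' * q + q' * s) * (r' * p + s' * r)"
    by (simp add: algebra_simps)
  also have "\<dots> = 1" using m1 m2 by simp
  finally have "\<bar>p * s - q * r\<bar> = 1" by (metis abs_mult abs_one mult.commute abs_zmult_eq_1)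
  moreover have "p * s - q * r > 0"
  proof -
    have cvC: "conj v * conj C = of_int p * conj w + of_int q"
      using arg_cong[OF Cv_eq, of conj] wK vK C by (simp add: conj_add conj_mult K_mult K_rat conj_rat)
    have cC: "conj C = of_int r * conj w + of_int s"
      using arg_cong[OF C_eq, of conj] wK C by (simp add: conj_add conj_mult K_mult K_rat conj_rat)
    have "v * C * conj C - C * (conj v * conj C) = of_int (p * s - q * r) * (w - conj w)"
      unfolding Cv_eq cvC unfolding cC unfolding C_eq by (simp add: algebra_simps)
    moreover have "v * C * conj C - C * (conj v * conj C) = (v - conj v) * (C * conj C)" by (simp add: algebra_simps)
    moreover have "(v - conj v) * (C * conj C) > 0" using vK C by simp
    ultimately have "of_int (p * s - q * r) * (w - conj w) > 0" by simp
    then have "(0::real) < of_int (p * s - q * r)" using wK by (simp add: zero_less_mult_iff)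
    then show ?thesis by linarith
  qed
  ultimately have det: "p * s - q * r = 1" by simp
  show ?thesis
  proof (cases "q \<ge> 0")
    case True
    then show ?thesis using reduced_chain[OF rw rv C Cv_eq C_eq det] by blast
  next
    case False
    \<comment> \<open>The inverse matrix expresses \<open>w\<close> and \<open>1\<close> in the basis \<open>v * C\<close>, \<open>C\<close>; dividing by \<open>C\<close>
      gives the hypotheses of the chain lemma with the roles exchanged.\<close>
    have C1: "1 / C \<in> K" "totally_positive (1 / C)" using C by (auto simp: K_divide K_rat conj_divide conj_rat)
    have detR: "of_int p * of_int s - of_int q * of_int r = (1::real)"
      using arg_cong[OF det, of "of_int :: int \<Rightarrow> real"] by simp
    have a: "w = of_int s * (v * C) - of_int q * C"
    proof -
      have "of_int s * (v * C) - of_int q * C = (of_int p * of_int s - of_int q * of_int r) * w"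
        unfolding Cv_eq unfolding C_eq by (simp add: algebra_simps)
      then show ?thesis using detR by simp
    qed
    have b: "1 = - of_int r * (v * C) + of_int p * C"
    proof -
      have "- of_int r * (v * C) + of_int p * C = (of_int p * of_int s - of_int q * of_int r)"
        unfolding Cv_eq unfolding C_eq by (simp add: algebra_simps)
      then show ?thesis using detR by simp
    qed
    have "w * (1 / C) = of_int s * v + of_int (- q)"
      using a C by (simp add: field_simps)
    moreover have "1 / C = of_int (- r) * v + of_int p"
      using b C by (simp add: field_simps)
    moreover have "s * p - (- q) * (- r) = 1" using det by (simp add: mult.commute)
    ultimately show ?thesis using reduced_chain[OF rv rw C1] False by (metis neg_0_le_iff_le linorder_linear)
  qed
qed

text \<open>A finite set permuted with a single orbit: the ceilings along one period give the cycle.  The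
  continued fractions converge because the finitely many reduced numbers are bounded away
  from \<open>1\<close>.\<close>

lemma cycle_exists:
  assumes B: "B \<in> narrow_ideal_classes K"
  shows "\<exists>bs. is_cycle K B bs"
proof -
  let ?T = minus_cf_step
  have fin: "finite (Red K B)" by (rule finite_Red[OF B])
  have maps: "?T ` Red K B \<subseteq> Red K B" using minus_cf_step_Red[OF B] by blast
  have red: "reduced K x" if "x \<in> Red K B" for x using that by (simp add: Red_def)
  have inj: "inj_on ?T (Red K B)" by (intro inj_onI) (use minus_cf_step_inj red in blast)
  have mem: "(?T ^^ i) x \<in> Red K B" if "x \<in> Red K B" for i x by (induction i) (use that maps in auto)
  obtain w where w: "w \<in> Red K B" using Red_nonempty[OF B] by blast
  obtain r where r: "r > 0" "inj_on (\<lambda>i. (?T ^^ i) w) {..<r}" "\<And>i. (?T ^^ i) w = (?T ^^ (i mod r)) w"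
    by (rule finite_injective_orbit[OF fin maps inj w]) blast
  have reach: "\<exists>i. v = (?T ^^ i) w" if v: "v \<in> Red K B" for v
    using Red_connected[OF B w v]
  proof
    assume "\<exists>i. w = (?T ^^ i) v"
    then obtain i where i: "w = (?T ^^ i) v" by blast
    obtain t where t: "t > 0" "\<And>i. (?T ^^ i) v = (?T ^^ (i mod t)) v"
      by (rule finite_injective_orbit[OF fin maps inj v]) blast
    have "i * t = (i * t - i) + i" using t(1) by simp
    then have "(?T ^^ (i * t - i)) w = (?T ^^ (i * t)) v" unfolding i by (metis funpow_add o_apply)
    also have "\<dots> = v" using t(2)[of "i * t"] by simp
    finally show ?thesis by metis
  qed
  have img: "(\<lambda>i. (?T ^^ i) w) ` {..<r} = Red K B"
  proof (intro equalityI subsetI)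
    fix v assume "v \<in> Red K B"
    then obtain i where "v = (?T ^^ i) w" using reach by blast
    then have "v = (?T ^^ (i mod r)) w" using r(3) by simp
    then show "v \<in> (\<lambda>i. (?T ^^ i) w) ` {..<r}" using r(1) by simp
  qed (use mem[OF w] in auto)
  define bs where "bs = map (\<lambda>i. \<lceil>(?T ^^ i) w\<rceil>) [0..<r]"
  define \<mu> where "\<mu> = Min (Red K B)"
  have \<mu>: "\<mu> > 1" "\<And>x. x \<in> Red K B \<Longrightarrow> \<mu> \<le> x"
    using fin Red_nonempty[OF B] red unfolding \<mu>_def by (auto simp: reduced_def)
  have "cycle_number bs j = (?T ^^ j) w" for j
  proof -
    have "cycle_number bs j = minus_cf (\<lambda>i. \<lceil>(?T ^^ (j + i)) w\<rceil>)"
      unfolding cycle_number_def bs_def using r(1) by (simp flip: r(3))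
    also have "\<dots> = (?T ^^ (j + 0)) w"
      by (rule minus_cf_eq[OF \<mu>(1), of "\<lambda>i. (?T ^^ (j + i)) w"]) (use \<mu>(2) mem[OF w] in \<open>auto simp: minus_cf_step_def\<close>)
    finally show ?thesis by simp
  qed
  then have "cycle_number bs = (\<lambda>i. (?T ^^ i) w)" by (rule ext)
  then have "bij_betw (cycle_number bs) {..<length bs} (Red K B)"
    unfolding bij_betw_def using r(2) img by (simp add: bs_def)
  moreover have "b \<ge> 2" if "b \<in> set bs" for b
    using that reduced_minus_cf_step(1)[OF red[OF mem[OF w]]] by (auto simp: bs_def)
  moreover have "bs \<noteq> []" using r(1) by (simp add: bs_def)
  ultimately show ?thesis unfolding is_cycle_def by blast
qed

lemma class_cycle_bij:
  assumes B: "B \<in> narrow_ideal_classes K"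
  shows "bij_betw (cycle_number (class_cycle K B)) {..<class_length K B} (Red K B)"
  using someI_ex[OF cycle_exists[OF B]] unfolding class_cycle_def class_length_def is_cycle_def by blast

end

section \<open>The Kronecker limit type formula\<close>

theorem theorem4p4:
  fixes K :: "real set" and D :: int and B :: "real set set" and k :: nat
  assumes "real_quadratic_field K" and "discriminant K = D" and "D > 0"
    and "B \<in> narrow_ideal_classes K" and "k \<ge> 3"
  shows "complex_of_int D powr (of_nat k / 2) * partial_zeta (of_nat k) K B =
    (\<Sum>w\<in>Red K B. diff_op (k - 1) (herglotz k) (of_real w) (of_real (galois_conj K w)))"
proof -
  obtain \<theta> d where "quadratic_generator K \<theta> d"
    using real_quadratic_field_imp_generator[OF assms(1)] by blast
  then interpret quadratic_generator K \<theta> d .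
  define c where "c = cycle_number (class_cycle K B)"
  have bij: "bij_betw c {..<class_length K B} (Red K B)"
    unfolding c_def by (rule class_cycle_bij[OF assms(4)])
  have orbit_sum: "(\<Sum>\<^sub>\<infinity>(p, q)\<in>{1..} \<times> UNIV. of_nat p powr (of_nat k :: complex) / of_real (Qform K B j p q) powr of_nat k)
      = diff_op (k - 1) (herglotz k) (of_real (c j)) (of_real (conj (c j)))"
    if "j < class_length K B" for j
  proof -
    have "c j \<in> Red K B" using bij that by (auto dest: bij_betw_apply)
    then have w: "c j > 1" "0 < conj (c j)" "conj (c j) < 1" by (auto simp: Red_def reduced_def)
    have "((\<lambda>(p, q). (of_nat p / (1 / (of_real (c j) - of_real (conj (c j))) * (of_nat q + of_nat p * of_real (c j))
          * (of_nat q + of_nat p * of_real (conj (c j))))) ^ k)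
        has_sum diff_op (k - 1) (herglotz k) (of_real (c j)) (of_real (conj (c j)))) ({1..} \<times> UNIV)"
      by (rule diff_op_herglotz) (use w assms(5) in auto)
    also have "(\<lambda>(p, q). (of_nat p / (1 / (of_real (c j) - of_real (conj (c j))) * (of_nat q + of_nat p * of_real (c j))
          * (of_nat q + of_nat p * of_real (conj (c j))))) ^ k)
      = (\<lambda>(p, q). of_nat p powr (of_nat k :: complex) / of_real (Qform K B j p q) powr of_nat k)"
      using assms(5) by (simp add: fun_eq_iff powr_nat' Qform_def Let_def power_divide power_mult_distrib flip: c_def)
    finally show ?thesis by (rule infsumI)
  qed
  have "partial_zeta (of_nat k) K B =
     (\<Sum>j<class_length K B. diff_op (k - 1) (herglotz k) (of_real (c j)) (of_real (conj (c j))))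
     / of_int D powr (of_nat k / 2)"
    unfolding partial_zeta_def assms(2)
    by (intro arg_cong2[where f = "(/)"] sum.cong refl orbit_sum) auto
  also have "(\<Sum>j<class_length K B. diff_op (k - 1) (herglotz k) (of_real (c j)) (of_real (conj (c j))))
     = (\<Sum>w\<in>Red K B. diff_op (k - 1) (herglotz k) (of_real w) (of_real (conj w)))"
    by (rule sum.reindex_bij_betw[OF bij])
  finally show ?thesis using assms(3) by simp
qed

end
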